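(* For every integer $n\ge 2$, writing $M=n(n-1)/2$, $J'_e(n)=\{N : n\le N< n(n-1)/2,\ N \text{ an even integer}\}$ and $$\Lambda(N,n)=\sum_{k=1}^{n-2}|P(N-k-n+1,\,k-1,\,n-1,\,n-k-1)|,$$ one has $$|D(n)|=|D_0(n-1)|+2\sum_{N\in J'_e(n)}\Lambda(N,n)+\varepsilon_n\,\Lambda(M,n),$$ where $\varepsilon_n=1$ if $M$ is even and $\varepsilon_n=0$ if $M$ is odd. Moreover, there is an algorithm which, given $n\ge 2$ and the values $|D(i)|$ for all $i<n$, computes $|D(n)|$ in time $O(n^5)$ and space $O(n^5)$.
   Context: All graphs are finite, simple (no loops or multiple edges) and undirected. Degree sequences are unordered (i.e. regarded as multisets, written in non-increasing order). $D(n)$ is the set of zero-free degree sequences of length $n$: those sequences $d_1\ge d_2\ge\dots\ge d_n\ge 1$ of positive integers that are the vertex degrees of some graph on $n$ vertices. $D_0(n)$ is the set of degree sequences of length $n$ of graphs on $n$ vertices, where zero terms are allowed. A partition of an integer $N\ge 0$ is a non-increasing sequence of positive integers (parts) with sum $N$ (the empty partition is the only partition of $0$). For a partition $\pi$, $\pi_i$ and $\pi_i'$ denote the number of dots in the $i$-th row and the $i$-th column of its Ferrers diagram (so $\pi_i$ is the $i$-th part and $\pi'$ is the conjugate partition), $d(\pi)$ is the size (number of rows) of its Durfee square, i.e. of the largest upper-left square contained in its Ferrers diagram, and $r_i(\pi)=\pi_i'-\pi_i$ for $1\le i\le d(\pi)$. $P(N,k,l)$ is the set of partitions of $N$ into at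 most $l$ parts with largest part at most $k$ (empty if $N<0$, $k<0$ or $l<0$). For an integer $s$, $P(N,k,l,s)=\emptyset$ if $s<0$, and if $s\ge 0$, $$P(N,k,l,s)=\Big\{\pi\in P(N,k,l) : s+\sum_{i=1}^{j}r_i(\pi)\ge j \text{ for all } 1\le j\le d(\pi)\Big\}.$$ Cost model: time is the number of elementary operations (additions, subtractions and comparisons of integers, array accesses), each of unit cost; space is the number of integers stored. *)

theory Defs
  imports Complex_Main "HOL-Library.Multiset" "HOL-Library.Landau_Symbols"
begin

section \<open>Degree sequences\<close>

definition simple_graph :: "nat set \<Rightarrow> nat set set \<Rightarrow> bool" where
  "simple_graph V E \<longleftrightarrow> finite V \<and> (\<forall>e\<in>E. e \<subseteq> V \<and> card e = 2)"

definition degree :: "nat set set \<Rightarrow> nat \<Rightarrow> nat" where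
  "degree E v = card {e \<in> E. v \<in> e}"

text \<open>Degree sequences are unordered, hence multisets of length \<open>n\<close>.\<close>

definition degree_sequence :: "nat set \<Rightarrow> nat set set \<Rightarrow> nat multiset" where
  "degree_sequence V E = image_mset (degree E) (mset_set V)"

definition D0 :: "nat \<Rightarrow> nat multiset set" where
  "D0 n = {degree_sequence V E | V E. simple_graph V E \<and> card V = n}"

definition D :: "nat \<Rightarrow> nat multiset set" where
  "D n = {d \<in> D0 n. \<forall>x \<in># d. 1 \<le> x}"

section \<open>Partitions\<close>

definition is_partition :: "nat list \<Rightarrow> bool" where
  "is_partition \<pi> \<longleftrightarrow> sorted_wrt (\<ge>) \<pi> \<and> (\<forall>x\<in>set \<pi>. 0 < x)"

text \<open>Rows and columns of a Ferrers diagram are numbered from 1.\<close>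

definition ferrers :: "nat list \<Rightarrow> (nat \<times> nat) set" where
  "ferrers \<pi> = {(i, j). 1 \<le> i \<and> i \<le> length \<pi> \<and> 1 \<le> j \<and> j \<le> \<pi> ! (i - 1)}"

definition row :: "nat list \<Rightarrow> nat \<Rightarrow> nat" where
  "row \<pi> i = card {j. (i, j) \<in> ferrers \<pi>}"

definition col :: "nat list \<Rightarrow> nat \<Rightarrow> nat" where
  "col \<pi> j = card {i. (i, j) \<in> ferrers \<pi>}"

definition durfee :: "nat list \<Rightarrow> nat" where
  "durfee \<pi> = Max {d. {1..d} \<times> {1..d} \<subseteq> ferrers \<pi>}"

definition rk :: "nat list \<Rightarrow> nat \<Rightarrow> int" where
  "rk \<pi> i = int (col \<pi> i) - int (row \<pi> i)"

definition P3 :: "int \<Rightarrow> int \<Rightarrow> int \<Rightarrow> nat list set" where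
  "P3 N k l = (if N < 0 \<or> k < 0 \<or> l < 0 then {} else
     {\<pi>. is_partition \<pi> \<and> int (sum_list \<pi>) = N \<and> int (length \<pi>) \<le> l \<and> (\<forall>x\<in>set \<pi>. int x \<le> k)})"

definition P4 :: "int \<Rightarrow> int \<Rightarrow> int \<Rightarrow> int \<Rightarrow> nat list set" where
  "P4 N k l s = (if s < 0 then {} else
     {\<pi> \<in> P3 N k l. \<forall>j\<in>{1..durfee \<pi>}. s + (\<Sum>i=1..j. rk \<pi> i) \<ge> int j})"

definition M_of :: "nat \<Rightarrow> int" where
  "M_of n = int n * (int n - 1) div 2"

definition J'e :: "nat \<Rightarrow> int set" where
  "J'e n = {N. int n \<le> N \<and> N < M_of n \<and> even N}"

definition Lam :: "int \<Rightarrow> nat \<Rightarrow> nat" where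
  "Lam N n = (\<Sum>k\<in>{1..int n - 2}. card (P4 (N - k - int n + 1) (k - 1) (int n - 1) (int n - k - 1)))"

section \<open>Cost model\<close>

text \<open>
  Algorithms are programs of a while language over integer variables and multidimensional integer
  arrays. Addition, subtraction, comparison and array access have unit cost, and so does every
  assignment. There is no multiplication.
\<close>

type_synonym vname = string
type_synonym aname = string

datatype aexp = Const int | Var vname | Plus aexp aexp | Minus aexp aexp

datatype bexp = Less aexp aexp | Eq aexp aexp

datatype com =
    SKIP
  | Assign vname aexp
  | Load vname aname "aexp list"
  | Store aname "aexp list" aexp
  | New aname "aexp list"
  | Seq com com
  | Cond bexp com com
  | While bexp com

text \<open>An array consists of its list of dimensions and its contents.\<close>

type_synonym arr = "nat list \<times> (int list \<Rightarrow> int)"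

record state =
  vars :: "vname \<Rightarrow> int"
  arrs :: "aname \<Rightarrow> arr option"

primrec aval :: "aexp \<Rightarrow> (vname \<Rightarrow> int) \<Rightarrow> int" where
  "aval (Const c) \<sigma> = c"
| "aval (Var x) \<sigma> = \<sigma> x"
| "aval (Plus a b) \<sigma> = aval a \<sigma> + aval b \<sigma>"
| "aval (Minus a b) \<sigma> = aval a \<sigma> - aval b \<sigma>"

primrec acost :: "aexp \<Rightarrow> nat" where
  "acost (Const c) = 0"
| "acost (Var x) = 0"
| "acost (Plus a b) = 1 + acost a + acost b"
| "acost (Minus a b) = 1 + acost a + acost b"

primrec bval :: "bexp \<Rightarrow> (vname \<Rightarrow> int) \<Rightarrow> bool" where
  "bval (Less a b) \<sigma> \<longleftrightarrow> aval a \<sigma> < aval b \<sigma>"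
| "bval (Eq a b) \<sigma> \<longleftrightarrow> aval a \<sigma> = aval b \<sigma>"

primrec bcost :: "bexp \<Rightarrow> nat" where
  "bcost (Less a b) = 1 + acost a + acost b"
| "bcost (Eq a b) = 1 + acost a + acost b"

definition avals :: "aexp list \<Rightarrow> (vname \<Rightarrow> int) \<Rightarrow> int list" where
  "avals as \<sigma> = map (\<lambda>a. aval a \<sigma>) as"

definition acosts :: "aexp list \<Rightarrow> nat" where
  "acosts as = sum_list (map acost as)"

definition in_bounds :: "int list \<Rightarrow> nat list \<Rightarrow> bool" where
  "in_bounds = list_all2 (\<lambda>i d. 0 \<le> i \<and> i < int d)"

text \<open>
  \<open>exec c s t s'\<close>: started in \<open>s\<close>, program \<open>c\<close> terminates in \<open>s'\<close> after time \<open>t\<close>.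
  Accesses out of bounds, or to an array that was not allocated, get stuck. Allocation initialises
  the array with zeros, which is charged one unit per cell. Arrays are neither freed nor
  reallocated, so the storage in use is largest in the final state.
\<close>

inductive exec :: "com \<Rightarrow> state \<Rightarrow> nat \<Rightarrow> state \<Rightarrow> bool" where
  Skip: "exec SKIP s 0 s"
| Assign: "exec (Assign x a) s (1 + acost a) (s\<lparr>vars := (vars s)(x := aval a (vars s))\<rparr>)"
| Load: "\<lbrakk>arrs s A = Some (ds, f); in_bounds (avals is (vars s)) ds\<rbrakk> \<Longrightarrow>
    exec (Load x A is) s (2 + acosts is) (s\<lparr>vars := (vars s)(x := f (avals is (vars s)))\<rparr>)"
| Store: "\<lbrakk>arrs s A = Some (ds, f); in_bounds (avals is (vars s)) ds\<rbrakk> \<Longrightarrow>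
    exec (Store A is a) s (2 + acosts is + acost a)
      (s\<lparr>arrs := (arrs s)(A \<mapsto> (ds, f(avals is (vars s) := aval a (vars s))))\<rparr>)"
| New: "\<lbrakk>arrs s A = None; avals as (vars s) = map int ds\<rbrakk> \<Longrightarrow>
    exec (New A as) s (1 + acosts as + prod_list ds) (s\<lparr>arrs := (arrs s)(A \<mapsto> (ds, \<lambda>_. 0))\<rparr>)"
| Seq: "\<lbrakk>exec c1 s1 t1 s2; exec c2 s2 t2 s3\<rbrakk> \<Longrightarrow> exec (Seq c1 c2) s1 (t1 + t2) s3"
| CondTrue: "\<lbrakk>bval b (vars s); exec c1 s t s'\<rbrakk> \<Longrightarrow> exec (Cond b c1 c2) s (bcost b + t) s'"
| CondFalse: "\<lbrakk>\<not> bval b (vars s); exec c2 s t s'\<rbrakk> \<Longrightarrow> exec (Cond b c1 c2) s (bcost b + t) s'"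
| WhileFalse: "\<not> bval b (vars s) \<Longrightarrow> exec (While b c) s (bcost b) s"
| WhileTrue: "\<lbrakk>bval b (vars s1); exec c s1 t1 s2; exec (While b c) s2 t2 s3\<rbrakk> \<Longrightarrow>
    exec (While b c) s1 (bcost b + t1 + t2) s3"

inductive_cases SkipE: "exec SKIP s t s'"
inductive_cases AssignE: "exec (Assign x a) s t s'"
inductive_cases LoadE: "exec (Load x A is) s t s'"
inductive_cases StoreE: "exec (Store A is a) s t s'"
inductive_cases NewE: "exec (New A as) s t s'"
inductive_cases SeqE: "exec (Seq c1 c2) s t s'"
inductive_cases CondE: "exec (Cond b c1 c2) s t s'"
inductive_cases WhileE: "exec (While b c) s t s'"

lemma exec_deterministic:
  "exec c s t1 s1 \<Longrightarrow> exec c s t2 s2 \<Longrightarrow> t1 = t2 \<and> s1 = s2"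
proof (induction arbitrary: t2 s2 rule: exec.induct)
  case Skip then show ?case by (auto elim: SkipE)
next
  case Assign then show ?case by (auto elim: AssignE)
next
  case Load then show ?case by (auto elim!: LoadE)
next
  case Store then show ?case by (auto elim!: StoreE)
next
  case (New s A as ds)
  from New.prems show ?case
    by (rule NewE) (use New.hyps in \<open>auto simp: inj_map_eq_map[OF inj_of_nat]\<close>)
next
  case Seq from Seq.prems show ?case by (rule SeqE) (use Seq.IH in blast)
next
  case CondTrue from CondTrue.prems show ?case by (rule CondE) (use CondTrue in blast)+
next
  case CondFalse from CondFalse.prems show ?case by (rule CondE) (use CondFalse in blast)+
next
  case WhileFalse from WhileFalse.prems show ?case by (rule WhileE) (use WhileFalse in blast)+
next
  case WhileTrue from WhileTrue.prems show ?case by (rule WhileE) (use WhileTrue in blast)+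
qed

primrec avars :: "aexp \<Rightarrow> vname set" where
  "avars (Const c) = {}"
| "avars (Var x) = {x}"
| "avars (Plus a b) = avars a \<union> avars b"
| "avars (Minus a b) = avars a \<union> avars b"

primrec bvars :: "bexp \<Rightarrow> vname set" where
  "bvars (Less a b) = avars a \<union> avars b"
| "bvars (Eq a b) = avars a \<union> avars b"

primrec cvars :: "com \<Rightarrow> vname set" where
  "cvars SKIP = {}"
| "cvars (Assign x a) = insert x (avars a)"
| "cvars (Load x A is) = insert x (\<Union>a\<in>set is. avars a)"
| "cvars (Store A is a) = avars a \<union> (\<Union>b\<in>set is. avars b)"
| "cvars (New A as) = (\<Union>a\<in>set as. avars a)"
| "cvars (Seq c1 c2) = cvars c1 \<union> cvars c2"
| "cvars (Cond b c1 c2) = bvars b \<union> cvars c1 \<union> cvars c2"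
| "cvars (While b c) = bvars b \<union> cvars c"

text \<open>
  The input is a number in variable \<open>n\<close> and a list in the one-dimensional array \<open>input\<close>; the
  output is read from variable \<open>output\<close>.
\<close>

definition init_state :: "nat \<Rightarrow> nat list \<Rightarrow> state" where
  "init_state n xs =
     \<lparr>vars = (\<lambda>_. 0)(''n'' := int n),
      arrs = [''input'' \<mapsto> ([length xs], \<lambda>is. int (xs ! nat (hd is)))]\<rparr>"

text \<open>
  Number of integers stored when \<open>c\<close> has terminated in \<open>s\<close>: the variables and all array cells,
  including the input. The domain is finite, as it is so in \<^const>\<open>init_state\<close>.
\<close>

definition space :: "com \<Rightarrow> state \<Rightarrow> nat" where
  "space c s = card (insert ''n'' (cvars c)) + (\<Sum>A\<in>dom (arrs s). prod_list (fst (the (arrs s A))))"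

end

theory Submission
  imports Defs
begin

text \<open>
  Both parts rest on one description of degree sequences: padded with zeros, the graphical
  partitions are those of even size with \<open>r\<^sub>1 + \<dots> + r\<^sub>j \<ge> j\<close> on the Durfee square. Up to
  the Durfee square this condition is the system of inequalities of Erdos and Gallai, beyond it
  these inequalities are automatic (\<open>rank_ok_iff_EG\<close>). Their necessity is a double count; their
  sufficiency is Choudum's induction on the sum of the degrees (\<open>EG_sufficient\<close>).

  The second ingredient is hook removal. Deleting the first row, of length \<open>k\<close>, and the first column,
  of length \<open>l\<close>, shifts the ranks by one place and turns the rank condition with initial value
  \<open>s\<close> into the one with \<open>s + l - k - 1\<close> (\<open>rank_ok_hook\<close>).

  For the formula, split the zero-free sequences of length \<open>n\<close> by whether \<open>n - 1\<close> occurs. If it does,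
  the complementary graph has an isolated vertex, and deleting that vertex gives \<open>|D0 (n - 1)|\<close>. The
  remaining sequences are permuted by complementation, which sends the sum \<open>N\<close> to \<open>n (n - 1) - N\<close>; so
  sums below the middle value count twice and the middle value counts once. The
  sequences with a given sum and largest term \<open>k\<close> are counted by removing their outer hook, which
  gives \<open>Lam\<close> (\<open>Lam_eq\<close>).

  For the algorithm, the size of a partition matters only through its parity, and hook removal
  preserves the parity of the size plus \<open>s\<close>. Counting partitions in a \<open>k \<times> l\<close> box with rank condition
  \<open>s\<close> and even size plus \<open>s\<close> therefore needs a table with three indices only, and hook removal
  gives each entry from four earlier ones (\<open>ranked_box_rec\<close>). As \<open>s\<close> can be restricted to \<open>n * n\<close>
  values, the table has \<open>O(n\<^sup>4)\<close> entries and is filled in time \<open>O(n\<^sup>4)\<close>; the number \<open>|D n|\<close> is the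
  difference of two of its entries (\<open>card_D_ranked_box\<close>).
\<close>

section \<open>Degrees in simple graphs\<close>

definition nbrs :: "nat set set \<Rightarrow> nat \<Rightarrow> nat set" where
  "nbrs E v = {u. {u, v} \<in> E}"

lemma simple_graph_finite:
  assumes "simple_graph V E"
  shows "finite V" "finite E"
proof -
  show "finite V" using assms by (simp add: simple_graph_def)
  then show "finite E"
    by (rule finite_subset[rotated, OF finite_Pow_iff[THEN iffD2]])
      (use assms in \<open>auto simp: simple_graph_def\<close>)
qed

lemma nbrs_sub: "simple_graph V E \<Longrightarrow> nbrs E v \<subseteq> V - {v}"
  by (fastforce simp: simple_graph_def nbrs_def)

lemma degree_eq_card_nbrs:
  assumes "simple_graph V E"
  shows "degree E v = card (nbrs E v)"
proof -
  have "bij_betw (\<lambda>u. {u, v}) (nbrs E v) {e \<in> E. v \<in> e}"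
    unfolding bij_betw_def
  proof
    show "inj_on (\<lambda>u. {u, v}) (nbrs E v)"
      by (auto simp: inj_on_def doubleton_eq_iff)
    show "(\<lambda>u. {u, v}) ` nbrs E v = {e \<in> E. v \<in> e}"
    proof
      show "{e \<in> E. v \<in> e} \<subseteq> (\<lambda>u. {u, v}) ` nbrs E v"
      proof
        fix e assume e: "e \<in> {e \<in> E. v \<in> e}"
        then have "card e = 2" using assms by (auto simp: simple_graph_def)
        then obtain a b where "e = {a, b}" by (auto simp: card_2_iff)
        with e have "\<exists>u. e = {u, v}" by auto
        then obtain u where "e = {u, v}" ..
        with e show "e \<in> (\<lambda>u. {u, v}) ` nbrs E v" by (auto simp: nbrs_def)
      qed
    qed (auto simp: nbrs_def)
  qed
  then show ?thesis unfolding degree_def by (metis bij_betw_same_card)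
qed

lemma degree_insert:
  assumes "finite E" "e \<notin> E"
  shows "degree (insert e E) v = degree E v + (if v \<in> e then 1 else 0)"
proof -
  have "{e' \<in> insert e E. v \<in> e'} = (if v \<in> e then insert e {e' \<in> E. v \<in> e'} else {e' \<in> E. v \<in> e'})"
    by auto
  then show ?thesis using assms by (simp add: degree_def)
qed

lemma degree_remove:
  assumes "finite E" "e \<in> E"
  shows "degree E v = degree (E - {e}) v + (if v \<in> e then 1 else 0)"
  using degree_insert[of "E - {e}" e v] assms by (simp add: insert_absorb)

lemma sum_degree_even:
  assumes "simple_graph V E"
  shows "even (\<Sum>v\<in>V. degree E v)"
proof -
  note fin = simple_graph_finite[OF assms]
  have "(\<Sum>v\<in>V. degree E v) = (\<Sum>v\<in>V. \<Sum>e\<in>E. if v \<in> e then 1 else 0)"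
    using fin by (simp add: degree_def sum.If_cases Int_def)
  also have "\<dots> = (\<Sum>e\<in>E. \<Sum>v\<in>V. if v \<in> e then 1 else 0)" by (rule sum.swap)
  also have "\<dots> = (\<Sum>e\<in>E. 2)"
  proof (rule sum.cong)
    fix e assume "e \<in> E"
    then have "V \<inter> e = e" "card e = 2" using assms by (auto simp: simple_graph_def)
    then show "(\<Sum>v\<in>V. if v \<in> e then 1 else 0) = (2::nat)"
      using fin by (simp add: sum.If_cases)
  qed simp
  finally show ?thesis by simp
qed

lemma degree_complement:
  assumes "simple_graph V E" "v \<in> V"
  shows "degree ({e. e \<subseteq> V \<and> card e = 2} - E) v = card V - 1 - degree E v"
proof -
  let ?K = "{e. e \<subseteq> V \<and> card e = 2}"
  note fin = simple_graph_finite[OF assms(1)]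
  have K: "simple_graph V ?K" using fin by (auto simp: simple_graph_def)
  have "nbrs ?K v = V - {v}" using assms(2) by (auto simp: nbrs_def card_2_iff doubleton_eq_iff)
  then have full: "degree ?K v = card V - 1"
    using degree_eq_card_nbrs[OF K] assms(2) fin by simp
  have "{e \<in> ?K - E. v \<in> e} = {e \<in> ?K. v \<in> e} - {e \<in> E. v \<in> e}" by auto
  moreover have "{e \<in> E. v \<in> e} \<subseteq> {e \<in> ?K. v \<in> e}"
    using assms(1) by (auto simp: simple_graph_def)
  ultimately show ?thesis
    using full fin by (simp add: degree_def card_Diff_subset)
qed

section \<open>The theorem of Erdos and Gallai\<close>

text \<open>
  The inequality of Erdos and Gallai for the first \<open>k\<close> of \<open>n\<close> degrees, with \<open>k (k - 1)\<close> rewritten so that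
  no truncated subtraction occurs.
\<close>

definition EG :: "nat \<Rightarrow> (nat \<Rightarrow> nat) \<Rightarrow> nat \<Rightarrow> bool" where
  "EG n d k \<longleftrightarrow> (\<Sum>i<k. d i) + k \<le> k * k + (\<Sum>i\<in>{k..<n}. min (d i) k)"

definition antitone :: "nat \<Rightarrow> (nat \<Rightarrow> nat) \<Rightarrow> bool" where
  "antitone n d \<longleftrightarrow> (\<forall>i j. i \<le> j \<longrightarrow> j < n \<longrightarrow> d j \<le> d i)"

text \<open>
  The degrees of the first \<open>k\<close> vertices count pairs with a first component among these vertices. At
  most \<open>k (k - 1)\<close> of the pairs stay inside, and a vertex outside receives at most \<open>k\<close> edges
  and at most its own degree.
\<close>

lemma EG_necessary:
  assumes G: "simple_graph V E" and bij: "bij_betw v {..<n} V" and k: "k \<le> n"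
  shows "EG n (\<lambda>i. degree E (v i)) k"
proof -
  note fin = simple_graph_finite[OF G]
  let ?a = "\<lambda>i j. if {v j, v i} \<in> E then 1 else (0::nat)"
  have deg: "degree E (v i) = (\<Sum>j<n. ?a i j)" if "i < n" for i
  proof -
    have "nbrs E (v i) \<subseteq> V" using nbrs_sub[OF G] by auto
    then have "bij_betw v {j. j < n \<and> {v j, v i} \<in> E} (nbrs E (v i))"
      using bij by (auto simp: bij_betw_def nbrs_def inj_on_def image_iff subset_iff)
    then have "degree E (v i) = card {j. j < n \<and> {v j, v i} \<in> E}"
      using degree_eq_card_nbrs[OF G] by (metis bij_betw_same_card)
    then show ?thesis by (simp add: sum.If_cases Int_def lessThan_def)
  qed
  have split: "{..<n} = {..<k} \<union> {k..<n}" using k by auto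
  have inner: "(\<Sum>j<k. ?a i j) + 1 \<le> k" if "i < k" for i
  proof -
    have "{v i, v i} \<notin> E" using G by (auto simp: simple_graph_def)
    then have "(\<Sum>j<k. ?a i j) = (\<Sum>j\<in>{..<k} - {i}. ?a i j)"
      using that by (subst sum.remove[of _ i]) auto
    also have "\<dots> \<le> (\<Sum>j\<in>{..<k} - {i}. 1)" by (rule sum_mono) auto
    also have "\<dots> + 1 = k" using that by simp
    finally show ?thesis by simp
  qed
  have "(\<Sum>i<k. degree E (v i)) + k = (\<Sum>i<k. \<Sum>j<n. ?a i j) + k"
    using k by (simp add: deg)
  also have "\<dots> = (\<Sum>i<k. (\<Sum>j<k. ?a i j) + 1) + (\<Sum>i<k. \<Sum>j\<in>{k..<n}. ?a i j)"
    unfolding split by (subst sum.union_disjoint) (auto simp: sum.distrib simp del: One_nat_def)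
  also have "(\<Sum>i<k. (\<Sum>j<k. ?a i j) + 1) \<le> (\<Sum>i<k. k)"
    by (rule sum_mono) (use inner in auto)
  also have "(\<Sum>i<k. \<Sum>j\<in>{k..<n}. ?a i j) = (\<Sum>j\<in>{k..<n}. \<Sum>i<k. ?a i j)" by (rule sum.swap)
  also have "\<dots> \<le> (\<Sum>j\<in>{k..<n}. min (degree E (v j)) k)"
  proof (rule sum_mono)
    fix j assume j: "j \<in> {k..<n}"
    have "(\<Sum>i<k. ?a i j) \<le> (\<Sum>i<k. 1)" by (rule sum_mono) auto
    moreover have "(\<Sum>i<k. ?a i j) = (\<Sum>i<k. ?a j i)" by (simp add: insert_commute)
    moreover have "(\<Sum>i<k. ?a j i) \<le> (\<Sum>i<n. ?a j i)" by (rule sum_mono2) (use k in auto)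
    ultimately show "(\<Sum>i<k. ?a i j) \<le> min (degree E (v j)) k" using j deg[of j] by simp
  qed
  finally show ?thesis by (simp add: EG_def)
qed

text \<open>
  Beyond the Durfee square the inequalities follow from the earlier ones: if \<open>d k \<le> k\<close>, then all
  later terms are at most \<open>k\<close>, so passing from \<open>k\<close> to \<open>k + 1\<close> adds \<open>d k\<close> on the left and
  \<open>2 k - d k\<close> on the right (in the form with \<open>k (k - 1)\<close>). This is why the rank condition on the
  Durfee square alone characterises graphical partitions.
\<close>

lemma EG_beyond_Durfee:
  assumes anti: "antitone n d"
    and base: "\<And>k. 1 \<le> k \<Longrightarrow> k \<le> n \<Longrightarrow> k \<le> d (k - 1) \<Longrightarrow> EG n d k"
    and k: "k \<le> n"
  shows "EG n d k"
  using k
proof (induction k)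
  case 0
  then show ?case by (simp add: EG_def)
next
  case (Suc k)
  show ?case
  proof (cases "Suc k \<le> d k")
    case True
    then show ?thesis using base[of "Suc k"] Suc.prems by simp
  next
    case False
    have small: "d i \<le> k" if "k \<le> i" "i < n" for i
      using anti that False unfolding antitone_def by (metis le_trans not_less_eq_eq)
    have "(\<Sum>i<k. d i) + k \<le> k * k + (\<Sum>i\<in>{k..<n}. min (d i) k)"
      using Suc by (simp add: EG_def)
    also have "(\<Sum>i\<in>{k..<n}. min (d i) k) = (\<Sum>i\<in>{k..<n}. d i)"
      by (rule sum.cong) (use small in auto)
    also have "\<dots> = d k + (\<Sum>i\<in>{Suc k..<n}. d i)"
      using Suc.prems by (simp add: sum.atLeast_Suc_lessThan)
    also have "(\<Sum>i\<in>{Suc k..<n}. d i) = (\<Sum>i\<in>{Suc k..<n}. min (d i) (Suc k))"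
      by (rule sum.cong) (use small in \<open>auto simp: min_def le_Suc_eq\<close>)
    finally show ?thesis using small[of k] Suc.prems by (simp add: EG_def)
  qed
qed

definition realizable :: "nat \<Rightarrow> (nat \<Rightarrow> nat) \<Rightarrow> bool" where
  "realizable n d \<longleftrightarrow> (\<exists>E. simple_graph {..<n} E \<and> (\<forall>i<n. degree E i = d i))"

text \<open>
  The graph part of Choudum's induction. A realization \<open>E\<close> of the sequence with \<open>d t\<close> and \<open>d m\<close>
  decreased becomes one of \<open>d\<close> by adding the edge \<open>tm\<close>. If that edge is already there, then \<open>t\<close>
  has too few neighbours to see all vertices up to \<open>m\<close>, so it misses some \<open>w\<close>, and \<open>w\<close> has more
  neighbours than \<open>m\<close>; a neighbour \<open>x\<close> of \<open>w\<close> but not of \<open>m\<close> gives the exchange of \<open>xw\<close> for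
  \<open>wt\<close> and \<open>xm\<close>, which raises exactly the degrees of \<open>t\<close> and \<open>m\<close>.
\<close>

lemma Choudum_graph:
  assumes real: "realizable n e"
    and tm: "t < m" "m < n"
    and e: "\<And>i. e i = (if i = t \<or> i = m then d i - 1 else d i)"
    and pos: "0 < d m" "0 < d t"
    and zero: "\<And>i. m < i \<Longrightarrow> i < n \<Longrightarrow> d i = 0"
    and big: "\<And>i. i < m \<Longrightarrow> d m \<le> d i"
    and dt: "d t \<le> m"
  shows "realizable n d"
proof -
  obtain E where G: "simple_graph {..<n} E" and deg: "\<And>i. i < n \<Longrightarrow> degree E i = e i"
    using real by (auto simp: realizable_def)
  note fin = simple_graph_finite[OF G]
  have E: "\<And>a b. {a, b} \<in> E \<Longrightarrow> a < n \<and> b < n \<and> a \<noteq> b"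
    using G by (auto simp: simple_graph_def)
  show ?thesis
  proof (cases "{t, m} \<in> E")
    case False
    have "simple_graph {..<n} (insert {t, m} E)"
      using G tm by (auto simp: simple_graph_def)
    moreover have "degree (insert {t, m} E) i = d i" if "i < n" for i
      using degree_insert[OF fin(2) False, of i] deg[OF that] e[of i] tm pos by auto
    ultimately show ?thesis by (auto simp: realizable_def)
  next
    case True
    have cardn: "card (nbrs E i) = e i" if "i < n" for i
      using degree_eq_card_nbrs[OF G] deg[OF that] by simp
    have finn: "finite (nbrs E i)" for i using nbrs_sub[OF G, of i] finite_subset by blast
    have nbr_m: "nbrs E t \<subseteq> {..m} - {t}"
    proof
      fix u assume u: "u \<in> nbrs E t"
      then have "u < n" "u \<noteq> t" using E by (auto simp: nbrs_def)
      moreover have "u \<le> m"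
      proof (rule ccontr)
        assume "\<not> u \<le> m"
        then have "e u = 0" using zero[of u] \<open>u < n\<close> e[of u] tm by simp
        then have "nbrs E u = {}" using cardn[OF \<open>u < n\<close>] finn by simp
        then show False using u by (auto simp: nbrs_def insert_commute)
      qed
      ultimately show "u \<in> {..m} - {t}" by simp
    qed
    \<comment> \<open>The vertices beyond \<open>m\<close> are isolated, so \<open>t\<close> has only \<open>m\<close> possible neighbours.\<close>
    have "card (nbrs E t) < card ({..m} - {t})"
      using cardn[of t] tm dt pos e[of t] by simp
    then have "\<not> {..m} - {t} \<subseteq> nbrs E t"
      using card_mono[OF finn, of "{..m} - {t}" t] by auto
    then obtain w where w: "w \<le> m" "w \<noteq> t" "w \<notin> nbrs E t"
      by auto
    then have wt: "{w, t} \<notin> E" by (simp add: nbrs_def)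
    have "w < m" using w wt True by (metis insert_commute le_neq_implies_less)
    then have "card (nbrs E m) < card (nbrs E w)"
      using cardn[of w] cardn[of m] e[of w] e[of m] big[of w] pos tm w by auto
    then have lt: "card (nbrs E m - nbrs E w) < card (nbrs E w - nbrs E m)"
      using card_Diff_subset_Int[of "nbrs E m" "nbrs E w"] card_Diff_subset_Int[of "nbrs E w" "nbrs E m"]
      by (simp add: finn Int_commute card_mono diff_less_mono)
    have "t \<in> nbrs E m - nbrs E w"
      using True wt by (auto simp: nbrs_def insert_commute)
    then have "1 \<le> card (nbrs E m - nbrs E w)"
      using finn by (metis One_nat_def Suc_leI card_gt_0_iff empty_iff finite_Diff)
    then have "\<not> nbrs E w - nbrs E m \<subseteq> {m}"
      using lt card_mono[of "{m}" "nbrs E w - nbrs E m"] by auto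
    then obtain x where x: "{x, w} \<in> E" "{x, m} \<notin> E" "x \<noteq> m"
      by (auto simp: nbrs_def)
    have ne: "x \<noteq> t" "x \<noteq> w" "x < n" "w < n" "w \<noteq> m" "t < n"
      using x wt E[OF x(1)] \<open>w < m\<close> tm by (auto simp: insert_commute)
    let ?E1 = "E - {{x, w}}" let ?E2 = "insert {w, t} ?E1" let ?E3 = "insert {x, m} ?E2"
    have f1: "finite ?E1" "finite ?E2" using fin by auto
    have n1: "{w, t} \<notin> ?E1" using wt by simp
    have n2: "{x, m} \<notin> ?E2" using x ne by (auto simp: doubleton_eq_iff)
    have "simple_graph {..<n} ?E3"
      using G tm ne x w by (auto simp: simple_graph_def)
    moreover have "degree ?E3 i = d i" if "i < n" for i
    proof -
      have ei: "degree E i = e i" by (rule deg[OF that])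
      have total: "degree ?E3 i + (if i \<in> {x, w} then 1 else 0)
          = e i + (if i \<in> {w, t} then 1 else 0) + (if i \<in> {x, m} then 1 else 0)"
        unfolding degree_insert[OF f1(2) n2] degree_insert[OF f1(1) n1] ei[symmetric]
          degree_remove[OF fin(2) x(1)] by simp
      have ed: "e i + (if i = t then 1 else 0) + (if i = m then 1 else 0) = d i"
        using e[of i] pos tm by simp
      consider "i = x" | "i = w" | "i = t" | "i = m" | "i \<notin> {x, w, t, m}" by auto
      then show ?thesis using total ed ne(1,2,5) x(3) w(2) tm(1) by cases simp_all
    qed
    ultimately show ?thesis by (auto simp: realizable_def)
  qed
qed

lemma Choudum_antitone:
  assumes anti: "antitone n d" and tm: "t < m" "m < n"
    and desc: "d (Suc t) < d t \<or> Suc t = m"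
    and zero: "\<And>i. m < i \<Longrightarrow> i < n \<Longrightarrow> d i = 0"
    and e: "\<And>i. e i = (if i = t \<or> i = m then d i - 1 else d i)"
  shows "antitone n e"
  unfolding antitone_def
proof (intro allI impI)
  fix i j assume ij: "i \<le> j" "j < n"
  have le: "d b \<le> d a" if "a \<le> b" "b < n" for a b
    using anti that by (auto simp: antitone_def)
  have ej: "e j \<le> d j" using e[of j] by simp
  consider "i = j" | "i = m" "m < j" | "i = t" "t < j" | "i \<noteq> m" "i \<noteq> t"
    using ij by linarith
  then show "e j \<le> e i"
  proof cases
    case 2
    then show ?thesis using zero[of j] ij ej by simp
  next
    case 3
    show ?thesis
    proof (cases "d (Suc t) < d t")
      case True
      then show ?thesis using le[of "Suc t" j] 3 ij ej e[of i] by simp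
    next
      case False
      then consider "j = m" | "m < j" using desc 3 by linarith
      then show ?thesis
        using zero[of j] ij ej le[of t m] e[of i] e[of j] 3 tm by cases auto
    qed
  next
    case 4
    then show ?thesis using le[OF ij] ej e[of i] by simp
  qed simp
qed

text \<open>
  The numerical part of Choudum's induction. Decreasing two terms can only hurt for \<open>k \<le> t\<close>, where
  the first \<open>k\<close> terms are all equal to \<open>d t\<close>. There the inequality has slack: trivially if
  \<open>d t < k\<close>, by parity of the sum if \<open>d t = k\<close>, and by the inequality for \<open>k + 1\<close> if
  \<open>d t > k\<close> and the decrease of \<open>d m\<close> matters at all, that is, if \<open>d m \<le> k\<close>.
\<close>

lemma Choudum_EG:
  assumes anti: "antitone n d" and EG: "\<And>k. k \<le> n \<Longrightarrow> EG n d k"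
    and ev: "even (\<Sum>i<n. d i)"
    and tm: "t < m" "m < n" and pos: "0 < d m"
    and flat: "\<And>i. i \<le> t \<Longrightarrow> d i = d t"
    and zero: "\<And>i. m < i \<Longrightarrow> i < n \<Longrightarrow> d i = 0"
    and e: "\<And>i. e i = (if i = t \<or> i = m then d i - 1 else d i)"
    and k: "k \<le> n"
  shows "EG n e k"
proof -
  have le: "d b \<le> d a" if "a \<le> b" "b < n" for a b
    using anti that by (auto simp: antitone_def)
  have post: "0 < d t" using le[of t m] tm pos by simp
  have init: "(\<Sum>i<j. d i) = j * d t" if "j \<le> Suc t" for j
  proof -
    have "(\<Sum>i<j. d i) = (\<Sum>i<j. d t)"
      by (rule sum.cong[OF refl], rule flat) (use that in auto)
    then show ?thesis by simp
  qed
  let ?A = "\<Sum>i<k. d i" and ?A' = "\<Sum>i<k. e i"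
  let ?B = "\<Sum>i\<in>{k..<n}. min (d i) k" and ?B' = "\<Sum>i\<in>{k..<n}. min (e i) k"
  have "?A = (\<Sum>i<k. e i + (if i = t then 1 else 0) + (if i = m then 1 else 0))"
    by (rule sum.cong) (use e tm pos post in auto)
  then have A: "?A = ?A' + (if t < k then 1 else 0) + (if m < k then 1 else 0)"
    by (simp add: sum.distrib)
  have "?B = (\<Sum>i\<in>{k..<n}. min (e i) k + (if i = t then (if d t \<le> k then 1 else 0) else 0)
      + (if i = m then (if d m \<le> k then 1 else 0) else 0))"
    by (rule sum.cong) (use e tm pos post in auto)
  then have B: "?B = ?B' + (if k \<le> t \<and> d t \<le> k then 1 else 0) + (if k \<le> m \<and> d m \<le> k then 1 else 0)"
    using tm by (simp add: sum.distrib)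
  have d: "?A + k \<le> k * k + ?B" using EG[OF k] by (simp add: EG_def)
  consider "m < k" | "t < k" "k \<le> m" | "k = 0" | "k \<le> t" "0 < k" "d t < k"
    | "k \<le> t" "0 < k" "d t = k" | "k \<le> t" "0 < k" "d t > k" by linarith
  then show ?thesis
  proof cases
    case 1
    then show ?thesis using d A B tm by (simp add: EG_def)
  next
    case 2
    then show ?thesis using d A B tm by (simp add: EG_def split: if_splits)
  next
    case 3
    then show ?thesis by (simp add: EG_def)
  next
    case 4
    have "?A' + k = k * (d t + 1)" using A 4 tm init[of k] by simp
    also have "\<dots> \<le> k * k" using 4 by (intro mult_le_mono2) simp
    finally show ?thesis by (simp add: EG_def)
  next
    case 5
    have small: "d i \<le> k" if "k \<le> i" "i < n" for i using le[of k i] that 5 flat[of k] by simp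
    have Ak: "?A = k * k" using init[of k] 5 by simp
    have Bs: "?B = (\<Sum>i\<in>{k..<n}. d i)" by (rule sum.cong) (use small in auto)
    have "(\<Sum>i<n. d i) = ?A + ?B" unfolding Bs using k
      by (simp add: lessThan_atLeast0 sum.atLeastLessThan_concat)
    \<comment> \<open>A tail of sum \<open>k + 1\<close> would make the total \<open>k * k + k + 1\<close>, which is odd.\<close>
    then have odd: "?B \<noteq> k + 1" using ev Ak by auto
    have "k + 1 \<le> d k + d m" using 5 flat[of k] pos by simp
    also have "\<dots> = (\<Sum>i\<in>{k, m}. d i)" using 5 tm by simp
    also have "\<dots> \<le> ?B" unfolding Bs by (rule sum_mono2) (use 5 tm in auto)
    finally have "k + 2 \<le> ?B" using odd by simp
    then show ?thesis using A B Ak 5 tm small[of m] by (simp add: EG_def)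
  next
    case 6
    show ?thesis
    proof (cases "d m \<le> k \<and> k * k + ?B \<le> ?A + k")
      case False
      then show ?thesis using d A B 6 tm by (auto simp: EG_def)
    next
      case True
      \<comment> \<open>Suppose the inequality for \<open>k\<close> is tight. The one for \<open>k + 1\<close> then forces more than \<open>d t - k\<close> terms of the tail above \<open>k\<close>, and these together with \<open>d m\<close> overfill the tail.\<close>
      let ?Q = "{i \<in> {k..<n}. k < d i}"
      let ?D = "d t" let ?q = "card ?Q"
      have Ak: "?A = k * ?D" using init[of k] 6 by simp
      have k1: "Suc k \<le> n" using 6 tm by simp
      have "(\<Sum>i<Suc k. d i) = Suc k * ?D" using init[of "Suc k"] 6 by simp
      then have E1: "Suc k * ?D + Suc k \<le> Suc k * Suc k + (\<Sum>i\<in>{Suc k..<n}. min (d i) (Suc k))"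
        using EG[OF k1] by (simp add: EG_def del: mult_Suc mult_Suc_right)
      have "(\<Sum>i\<in>{k..<n}. min (d i) (Suc k)) = (\<Sum>i\<in>{k..<n}. min (d i) k + (if k < d i then 1 else 0))"
        by (rule sum.cong) auto
      also have "\<dots> = ?B + ?q" by (simp add: sum.distrib sum.If_cases Int_def)
      finally have E2: "(\<Sum>i\<in>{k..<n}. min (d i) (Suc k)) = ?B + ?q" .
      have E3: "(\<Sum>i\<in>{k..<n}. min (d i) (Suc k)) = Suc k + (\<Sum>i\<in>{Suc k..<n}. min (d i) (Suc k))"
        using k1 flat[of k] 6 by (simp add: sum.atLeast_Suc_lessThan)
      have "?q * k + 1 = (\<Sum>i\<in>?Q. k) + 1" by simp
      also have "\<dots> \<le> (\<Sum>i\<in>?Q. min (d i) k) + min (d m) k"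
        by (rule add_mono, rule sum_mono) (use pos 6 in auto)
      also have "\<dots> = (\<Sum>i\<in>insert m ?Q. min (d i) k)" using True by simp
      also have "\<dots> \<le> ?B" by (rule sum_mono2) (use 6 tm in auto)
      finally have E4: "?q * k + 1 \<le> ?B" .
      have "Suc k * ?D + Suc k + Suc k \<le> Suc k * Suc k + ?B + ?q" using E1 E2 E3 by linarith
      then have "k * ?D + ?D + 2 * k + 2 \<le> k * k + 2 * k + 1 + ?B + ?q" by simp
      then have "?D + 1 \<le> k + ?q" using True Ak by linarith
      then have "k * (?D + 1) \<le> k * (k + ?q)" by (rule mult_le_mono2)
      then have "k * ?D + k \<le> k * k + ?q * k" by (simp add: algebra_simps)
      then have False using E4 True Ak by linarith
      then show ?thesis ..
    qed
  qed
qed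

text \<open>
  Induction on the sum: \<open>m\<close> is the last nonzero index, and \<open>t\<close> is the first descent before \<open>m\<close>,
  or \<open>m - 1\<close> if there is none, so that decreasing \<open>d t\<close> and \<open>d m\<close> keeps the sequence sorted.
\<close>

lemma EG_sufficient:
  assumes "antitone n d" and "\<And>k. k \<le> n \<Longrightarrow> EG n d k" and "even (\<Sum>i<n. d i)"
  shows "realizable n d"
  using assms
proof (induction "\<Sum>i<n. d i" arbitrary: d rule: less_induct)
  case less
  note anti = less.prems(1) and EG = less.prems(2) and ev = less.prems(3)
  show ?case
  proof (cases "\<forall>i<n. d i = 0")
    case True
    then have "simple_graph {..<n} {} \<and> (\<forall>i<n. degree {} i = d i)"
      by (simp add: simple_graph_def degree_def)
    then show ?thesis unfolding realizable_def by blast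
  next
    case False
    define m where "m = Max {i. i < n \<and> 0 < d i}"
    have fin: "finite {i. i < n \<and> 0 < d i}" by simp
    have "m \<in> {i. i < n \<and> 0 < d i}"
      unfolding m_def using False by (intro Max_in) auto
    then have m: "m < n" "0 < d m" by auto
    have zero: "d i = 0" if "m < i" "i < n" for i
      using that Max_ge[OF fin, of i] by (auto simp: m_def[symmetric] not_le)
    have le: "d b \<le> d a" if "a \<le> b" "b < n" for a b
      using anti that by (auto simp: antitone_def)
    have "d 0 + 1 \<le> 1 + (\<Sum>i\<in>{1..<n}. min (d i) 1)"
      using EG[of 1] m by (simp add: EG_def)
    also have "(\<Sum>i\<in>{1..<n}. min (d i) 1) = (\<Sum>i\<in>{1..m}. min (d i) 1)"
      by (rule sum.mono_neutral_right) (use m zero in auto)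
    also have "\<dots> \<le> (\<Sum>i\<in>{1..m}. 1)" by (rule sum_mono) simp
    finally have d0: "d 0 \<le> m" by simp
    then have mpos: "0 < m" using m by (metis gr0I le_zero_eq less_irrefl)
    define t where "t = (LEAST t. d (Suc t) < d t \<or> Suc t = m)"
    have ex: "d (Suc (m - 1)) < d (m - 1) \<or> Suc (m - 1) = m" using mpos by simp
    have desc: "d (Suc t) < d t \<or> Suc t = m" unfolding t_def by (rule LeastI, rule ex)
    have "t \<le> m - 1" unfolding t_def by (rule Least_le, rule ex)
    then have tm: "t < m" using mpos by simp
    have flat0: "d i = d 0" if "i \<le> t" for i
      using that
    proof (induction i)
      case (Suc i)
      then have "\<not> (d (Suc i) < d i \<or> Suc i = m)"
        using not_less_Least[of i "\<lambda>t. d (Suc t) < d t \<or> Suc t = m"] unfolding t_def by auto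
      then show ?case using le[of i "Suc i"] Suc tm m by simp
    qed simp
    have flat: "d i = d t" if "i \<le> t" for i using flat0[OF that] flat0[of t] by simp
    define e where "e = (\<lambda>i. if i = t \<or> i = m then d i - 1 else d i)"
    have e: "e i = (if i = t \<or> i = m then d i - 1 else d i)" for i by (simp add: e_def)
    have dt: "0 < d t" using le[of t m] tm m by simp
    have "(\<Sum>i<n. d i) = (\<Sum>i<n. e i + (if i = t then 1 else 0) + (if i = m then 1 else 0))"
      by (rule sum.cong) (use tm m dt in \<open>auto simp: e_def\<close>)
    then have sum: "(\<Sum>i<n. d i) = (\<Sum>i<n. e i) + 2" using tm m by (simp add: sum.distrib)
    have "realizable n e"
    proof (rule less.hyps)
      show "(\<Sum>i<n. e i) < (\<Sum>i<n. d i)" using sum by simp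
      show "antitone n e" by (rule Choudum_antitone[OF anti tm m(1) desc zero e])
      show "EG n e k" if "k \<le> n" for k
        by (rule Choudum_EG[OF anti EG ev tm m flat zero e that])
      show "even (\<Sum>i<n. e i)" using ev sum by simp
    qed
    then show ?thesis
      by (rule Choudum_graph[OF _ tm m(1) e m(2) dt zero]) (use le m flat0[of t] d0 in auto)
  qed
qed

section \<open>Graphical partitions\<close>

text \<open>
  The rows of the Ferrers diagram from 0, continued by 0 below the diagram: a padded degree sequence
  is then a partition read as a function.
\<close>

definition part :: "nat list \<Rightarrow> nat \<Rightarrow> nat" where
  "part \<pi> i = (if i < length \<pi> then \<pi> ! i else 0)"

lemma part_antimono: "is_partition \<pi> \<Longrightarrow> i \<le> j \<Longrightarrow> part \<pi> j \<le> part \<pi> i"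
  by (cases "i = j") (auto simp: part_def is_partition_def sorted_wrt_iff_nth_less)

lemma part_pos: "is_partition \<pi> \<Longrightarrow> 0 < part \<pi> i \<longleftrightarrow> i < length \<pi>"
  by (auto simp: part_def is_partition_def)

lemma part_0: "\<pi> \<noteq> [] \<Longrightarrow> part \<pi> 0 = hd \<pi>"
  by (simp add: part_def hd_conv_nth)

lemma part_le: "(\<And>x. x \<in> set \<pi> \<Longrightarrow> x \<le> k) \<Longrightarrow> part \<pi> i \<le> k"
  by (simp add: part_def)

lemma le_hd_partition: "is_partition \<pi> \<Longrightarrow> x \<in> set \<pi> \<Longrightarrow> x \<le> hd \<pi>"
  by (cases \<pi>) (auto simp: is_partition_def)

lemma ferrers_Suc: "(Suc i, Suc j) \<in> ferrers \<pi> \<longleftrightarrow> j < part \<pi> i"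
  by (auto simp: ferrers_def part_def)

lemma row_Suc: "row \<pi> (Suc i) = part \<pi> i"
proof -
  have "{j. (Suc i, j) \<in> ferrers \<pi>} = {1..part \<pi> i}" by (auto simp: ferrers_def part_def)
  then show ?thesis by (simp add: row_def)
qed

lemma col_Suc: "col \<pi> (Suc j) = card {i. j < part \<pi> i}"
proof -
  have "{i. (i, Suc j) \<in> ferrers \<pi>} = Suc ` {i. j < part \<pi> i}"
  proof (rule set_eqI)
    fix i show "i \<in> {i. (i, Suc j) \<in> ferrers \<pi>} \<longleftrightarrow> i \<in> Suc ` {i. j < part \<pi> i}"
      by (cases i) (auto simp: ferrers_Suc, simp add: ferrers_def)
  qed
  then show ?thesis by (simp add: col_def card_image)
qed

lemma sum_row: "(\<Sum>i=1..j. row \<pi> i) = (\<Sum>i<j. part \<pi> i)"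
  by (induction j) (simp_all add: row_Suc)

text \<open>
  The first \<open>j\<close> columns meet row \<open>i\<close> in \<open>min (part \<pi> i) j\<close> dots.
\<close>

lemma sum_col:
  assumes "length \<pi> \<le> n"
  shows "(\<Sum>i=1..j. col \<pi> i) = (\<Sum>i<n. min (part \<pi> i) j)"
proof (induction j)
  case (Suc j)
  have "{i. j < part \<pi> i} = {i \<in> {..<n}. j < part \<pi> i}"
    using assms by (auto simp: part_def split: if_splits)
  then have "col \<pi> (Suc j) = (\<Sum>i<n. if j < part \<pi> i then 1 else 0)"
    by (simp add: col_Suc sum.If_cases Int_def)
  moreover have "(\<Sum>i<n. min (part \<pi> i) (Suc j)) = (\<Sum>i<n. min (part \<pi> i) j + (if j < part \<pi> i then 1 else 0))"
    by (rule sum.cong) auto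
  ultimately show ?case using Suc by (simp add: sum.distrib)
qed simp

text \<open>
  Quantifying over diagonal cells instead of the size of the Durfee square makes the condition
  local, which is what hook removal needs.
\<close>

definition rank_ok :: "int \<Rightarrow> nat list \<Rightarrow> bool" where
  "rank_ok s \<pi> \<longleftrightarrow> (\<forall>j\<ge>1. (j, j) \<in> ferrers \<pi> \<longrightarrow> int j \<le> s + (\<Sum>i=1..j. rk \<pi> i))"

lemma diagonal_down:
  assumes "is_partition \<pi>" "1 \<le> i" "i \<le> j" "(j, j) \<in> ferrers \<pi>"
  shows "(i, i) \<in> ferrers \<pi>"
proof -
  obtain a b where "i = Suc a" "j = Suc b" using assms by (metis Suc_le_D One_nat_def le_trans)
  then show ?thesis using assms part_antimono[OF assms(1), of a b] by (auto simp: ferrers_Suc)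
qed

lemma le_durfee_iff:
  assumes "is_partition \<pi>" "1 \<le> j"
  shows "j \<le> durfee \<pi> \<longleftrightarrow> (j, j) \<in> ferrers \<pi>"
proof -
  let ?S = "{d. {1..d} \<times> {1..d} \<subseteq> ferrers \<pi>}"
  have S: "d \<in> ?S \<longleftrightarrow> d = 0 \<or> (d, d) \<in> ferrers \<pi>" for d
  proof (cases d)
    case (Suc c)
    have "(x, y) \<in> ferrers \<pi>" if "(d, d) \<in> ferrers \<pi>" "x \<in> {1..d}" "y \<in> {1..d}" for x y
    proof -
      obtain a b where "x = Suc a" "y = Suc b" using \<open>x \<in> {1..d}\<close> \<open>y \<in> {1..d}\<close>
        by (metis Suc_le_D One_nat_def atLeastAtMost_iff)
      then show ?thesis using that Suc part_antimono[OF assms(1), of a c] by (auto simp: ferrers_Suc)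
    qed
    then show ?thesis using Suc by auto
  qed simp
  have "d \<le> length \<pi>" if "d \<in> ?S" for d
    using that unfolding S by (auto simp: ferrers_def)
  then have fin: "finite ?S" by (meson finite_nat_set_iff_bounded_le)
  have ne: "0 \<in> ?S" by simp
  have "durfee \<pi> \<in> ?S" unfolding durfee_def by (rule Max_in) (use fin ne in blast)+
  then have "durfee \<pi> = 0 \<or> (durfee \<pi>, durfee \<pi>) \<in> ferrers \<pi>" by (simp only: S)
  then have "j \<le> durfee \<pi> \<Longrightarrow> (j, j) \<in> ferrers \<pi>"
    using diagonal_down[OF assms] assms(2) by auto
  moreover have "(j, j) \<in> ferrers \<pi> \<Longrightarrow> j \<le> durfee \<pi>"
    unfolding durfee_def by (rule Max_ge[OF fin]) (use S in blast)
  ultimately show ?thesis by blast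
qed

lemma rank_ok_durfee:
  assumes "is_partition \<pi>"
  shows "rank_ok s \<pi> \<longleftrightarrow> (\<forall>j\<in>{1..durfee \<pi>}. s + (\<Sum>i=1..j. rk \<pi> i) \<ge> int j)"
  using le_durfee_iff[OF assms] by (auto simp: rank_ok_def)

text \<open>
  On the Durfee square, the first \<open>k\<close> rows have at least \<open>k\<close> dots each. So the sum of the first \<open>k\<close>
  columns is \<open>k * k\<close> plus the truncated rows after \<open>k\<close>, and the rank condition is the inequality
  of Erdos and Gallai.
\<close>

lemma rank_ok_iff_EG:
  assumes p: "is_partition \<pi>" and len: "length \<pi> \<le> n"
  shows "rank_ok 0 \<pi> \<longleftrightarrow> (\<forall>k\<le>n. EG n (part \<pi>) k)"
proof -
  have anti: "antitone n (part \<pi>)" using part_antimono[OF p] by (simp add: antitone_def)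
  have diag: "(k, k) \<in> ferrers \<pi> \<longleftrightarrow> k \<le> n \<and> k \<le> part \<pi> (k - 1)" if k: "1 \<le> k" for k
  proof -
    obtain a where "k = Suc a" using k by (cases k) auto
    then show ?thesis using len by (auto simp: ferrers_Suc part_def)
  qed
  have eq: "int k \<le> 0 + (\<Sum>i=1..k. rk \<pi> i) \<longleftrightarrow> EG n (part \<pi>) k"
    if k: "1 \<le> k" "k \<le> n" "k \<le> part \<pi> (k - 1)" for k
  proof -
    have "(\<Sum>i=1..k. rk \<pi> i) = int (\<Sum>i<n. min (part \<pi> i) k) - int (\<Sum>i<k. part \<pi> i)"
      by (simp add: rk_def sum_subtractf sum_col[OF len, symmetric] sum_row[symmetric])
    moreover have "(\<Sum>i<n. min (part \<pi> i) k) = (\<Sum>i<k. min (part \<pi> i) k) + (\<Sum>i\<in>{k..<n}. min (part \<pi> i) k)"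
      using k by (simp add: lessThan_atLeast0 sum.atLeastLessThan_concat)
    moreover have "(\<Sum>i<k. min (part \<pi> i) k) = k * k"
    proof -
      have "min (part \<pi> i) k = k" if "i < k" for i
        using part_antimono[OF p, of i "k - 1"] that k by linarith
      then show ?thesis by simp
    qed
    ultimately show ?thesis unfolding EG_def by linarith
  qed
  show ?thesis
  proof
    assume "rank_ok 0 \<pi>"
    then have "EG n (part \<pi>) k" if "1 \<le> k" "k \<le> n" "k \<le> part \<pi> (k - 1)" for k
      using eq[OF that] diag[OF that(1)] that unfolding rank_ok_def by blast
    then show "\<forall>k\<le>n. EG n (part \<pi>) k" using EG_beyond_Durfee[OF anti] by blast
  next
    assume "\<forall>k\<le>n. EG n (part \<pi>) k"
    then show "rank_ok 0 \<pi>" using eq diag unfolding rank_ok_def by blast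
  qed
qed

definition graphic :: "nat list \<Rightarrow> bool" where
  "graphic \<pi> \<longleftrightarrow> is_partition \<pi> \<and> even (sum_list \<pi>) \<and> rank_ok 0 \<pi>"

definition pad :: "nat \<Rightarrow> nat list \<Rightarrow> nat multiset" where
  "pad n \<pi> = mset \<pi> + replicate_mset (n - length \<pi>) 0"

lemma map_part:
  assumes "length \<pi> \<le> n"
  shows "map (part \<pi>) [0..<n] = \<pi> @ replicate (n - length \<pi>) 0"
  by (rule nth_equalityI) (use assms in \<open>auto simp: part_def nth_append\<close>)

lemma sum_part: "length \<pi> \<le> n \<Longrightarrow> (\<Sum>i<n. part \<pi> i) = sum_list \<pi>"
  using arg_cong[OF map_part, of \<pi> n sum_list]
  by (simp add: interv_sum_list_conv_sum_set_nat lessThan_atLeast0 sum_list_replicate)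

lemma sorted_split_zeros:
  assumes "sorted_wrt (\<ge>) xs"
  shows "filter ((<) 0) xs @ replicate (length xs - length (filter ((<) 0) xs)) (0::nat) = xs"
  using assms
proof (induction xs)
  case (Cons x xs)
  show ?case
  proof (cases "x = 0")
    case True
    then have "\<forall>y\<in>set (x # xs). y = 0" using Cons.prems by auto
    then have "replicate (length (x # xs)) 0 = x # xs" by (metis replicate_length_same)
    moreover have "filter ((<) 0) (x # xs) = []"
      using \<open>\<forall>y\<in>set (x # xs). y = 0\<close> by (auto simp: filter_empty_conv)
    ultimately show ?thesis by simp
  next
    case False
    then show ?thesis using Cons by simp
  qed
qed simp

text \<open>
  Degree sequences are exactly the graphical partitions padded with zeros. One inclusion sorts the
  vertices by degree and is the necessity of the inequalities, the other one is their
  sufficiency.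
\<close>

lemma D0_eq: "D0 n = pad n ` {\<pi>. graphic \<pi> \<and> length \<pi> \<le> n}"
proof (intro set_eqI iffI)
  fix d assume "d \<in> D0 n"
  then obtain V E where G: "simple_graph V E" and n: "card V = n" and d: "d = degree_sequence V E"
    by (auto simp: D0_def)
  have fin: "finite V" using G by (simp add: simple_graph_def)
  define vs where "vs = rev (sort_key (degree E) (sorted_list_of_set V))"
  define xs where "xs = map (degree E) vs"
  have vs: "set vs = V" "distinct vs" "length vs = n"
    using fin n by (simp_all add: vs_def)
  have "mset vs = mset_set V" using vs by (metis mset_set_set)
  then have dxs: "d = mset xs" by (simp add: d degree_sequence_def xs_def)
  have lxs: "length xs = n" using vs by (simp add: xs_def)
  have sorted: "sorted_wrt (\<ge>) xs"
    unfolding xs_def vs_def rev_map[symmetric] sorted_wrt_rev using sorted_sort_key by blast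
  define \<pi> where "\<pi> = filter ((<) 0) xs"
  have xs: "xs = \<pi> @ replicate (n - length \<pi>) 0"
    using sorted_split_zeros[OF sorted, symmetric] lxs unfolding \<pi>_def by simp
  have len: "length \<pi> \<le> n" using lxs unfolding \<pi>_def by (metis length_filter_le)
  have p: "is_partition \<pi>"
    using sorted by (simp add: \<pi>_def is_partition_def sorted_wrt_filter)
  have part: "part \<pi> i = degree E (vs ! i)" if "i < n" for i
  proof -
    have "part \<pi> i = xs ! i" using that len by (subst xs) (auto simp: part_def nth_append)
    then show ?thesis using that vs by (simp add: xs_def)
  qed
  have bij: "bij_betw ((!) vs) {..<n} V" using vs bij_betw_nth by blast
  have "EG n (part \<pi>) k" if "k \<le> n" for k
  proof -
    have "EG n (part \<pi>) k \<longleftrightarrow> EG n (\<lambda>i. degree E (vs ! i)) k"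
      unfolding EG_def using that part by simp
    then show ?thesis using EG_necessary[OF G bij that] by simp
  qed
  then have "rank_ok 0 \<pi>" using rank_ok_iff_EG[OF p len] by blast
  moreover have "even (sum_list \<pi>)"
  proof -
    have "sum_list \<pi> = sum_mset d" by (simp add: dxs xs sum_mset_sum_list sum_list_replicate)
    also have "\<dots> = (\<Sum>v\<in>V. degree E v)" by (simp add: d degree_sequence_def sum_unfold_sum_mset)
    finally show ?thesis using sum_degree_even[OF G] by simp
  qed
  moreover have "d = pad n \<pi>" by (simp add: dxs xs pad_def)
  ultimately show "d \<in> pad n ` {\<pi>. graphic \<pi> \<and> length \<pi> \<le> n}"
    using p len by (auto simp: graphic_def)
next
  fix d assume "d \<in> pad n ` {\<pi>. graphic \<pi> \<and> length \<pi> \<le> n}"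
  then obtain \<pi> where d: "d = pad n \<pi>" and g: "graphic \<pi>" and len: "length \<pi> \<le> n" by auto
  have p: "is_partition \<pi>" using g by (simp add: graphic_def)
  have "realizable n (part \<pi>)"
  proof (rule EG_sufficient)
    show "antitone n (part \<pi>)" using part_antimono[OF p] by (simp add: antitone_def)
    show "EG n (part \<pi>) k" if "k \<le> n" for k
      using g rank_ok_iff_EG[OF p len] that by (simp add: graphic_def)
    show "even (\<Sum>i<n. part \<pi> i)" using g sum_part[OF len] by (simp add: graphic_def)
  qed
  then obtain E where G: "simple_graph {..<n} E" and deg: "\<forall>i<n. degree E i = part \<pi> i"
    by (auto simp: realizable_def)
  have "degree_sequence {..<n} E = image_mset (part \<pi>) (mset_set {..<n})"
    unfolding degree_sequence_def by (rule image_mset_cong) (use deg in auto)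
  also have "\<dots> = mset (map (part \<pi>) [0..<n])"
    by (simp add: lessThan_atLeast0 atLeast_upt flip: mset_set_set)
  also have "\<dots> = d" by (simp add: map_part[OF len] d pad_def)
  finally show "d \<in> D0 n" using G unfolding D0_def by force
qed

lemma partition_eqI:
  assumes "is_partition \<pi>" "is_partition \<rho>" "mset \<pi> = mset \<rho>"
  shows "\<pi> = \<rho>"
proof -
  have "sorted (rev \<pi>)" "sorted (rev \<rho>)" using assms by (simp_all add: is_partition_def sorted_wrt_rev)
  then have "rev \<pi> = rev \<rho>" using assms(3) by (metis mset_rev properties_for_sort)
  then show ?thesis by simp
qed

lemma inj_pad: "inj_on (pad n) {\<pi>. is_partition \<pi>}"
proof (rule inj_onI)
  fix \<pi> \<rho> assume p: "\<pi> \<in> {\<pi>. is_partition \<pi>}" "\<rho> \<in> {\<pi>. is_partition \<pi>}" and eq: "pad n \<pi> = pad n \<rho>"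
  have pos: "filter_mset ((<) 0) (pad n \<sigma>) = mset \<sigma>" if "is_partition \<sigma>" for \<sigma>
  proof -
    have "filter ((<) 0) \<sigma> = \<sigma>" using that by (simp add: is_partition_def)
    then have "filter_mset ((<) 0) (mset \<sigma>) = mset \<sigma>" by (metis mset_filter)
    then show ?thesis by (simp add: pad_def)
  qed
  show "\<pi> = \<rho>" using p eq pos[of \<pi>] pos[of \<rho>] by (intro partition_eqI) simp_all
qed

lemma zero_in_pad: "is_partition \<pi> \<Longrightarrow> 0 \<in># pad n \<pi> \<longleftrightarrow> length \<pi> < n"
  by (auto simp: pad_def is_partition_def)

lemma D_eq: "D n = pad n ` {\<pi>. graphic \<pi> \<and> length \<pi> = n}"
proof -
  have "(\<forall>x\<in>#pad n \<pi>. 1 \<le> x) \<longleftrightarrow> \<not> length \<pi> < n" if "is_partition \<pi>" for \<pi>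
    using zero_in_pad[OF that, of n] by (metis less_one not_le)
  then show ?thesis by (force simp: D_def D0_eq graphic_def)
qed

lemma card_pad: "(\<And>\<pi>. \<pi> \<in> X \<Longrightarrow> is_partition \<pi>) \<Longrightarrow> card (pad n ` X) = card X"
  by (rule card_image) (rule inj_on_subset[OF inj_pad], auto)

lemma card_D0: "card (D0 n) = card {\<pi>. graphic \<pi> \<and> length \<pi> \<le> n}"
  unfolding D0_eq by (rule card_pad) (simp add: graphic_def)

lemma card_D: "card (D n) = card {\<pi>. graphic \<pi> \<and> length \<pi> = n}"
  unfolding D_eq by (rule card_pad) (simp add: graphic_def)

text \<open>
  The rank condition at the first diagonal cell says that the largest part is smaller than the
  number of parts.
\<close>

lemma graphic_hd_less:
  assumes "graphic \<pi>" "\<pi> \<noteq> []"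
  shows "hd \<pi> < length \<pi>"
proof -
  have p: "is_partition \<pi>" using assms by (simp add: graphic_def)
  have "(1, 1) \<in> ferrers \<pi>" using part_pos[OF p, of 0] assms ferrers_Suc[of 0 0 \<pi>] by simp
  then have "1 \<le> rk \<pi> 1" using assms(1) by (force simp: graphic_def rank_ok_def)
  moreover have "col \<pi> 1 = length \<pi>" using col_Suc[of \<pi> 0] by (simp add: part_pos[OF p])
  moreover have "row \<pi> 1 = hd \<pi>" using row_Suc[of \<pi> 0] part_0[OF assms(2)] by simp
  ultimately show ?thesis by (simp add: rk_def)
qed

lemma finite_box: "finite {\<pi>. length \<pi> \<le> l \<and> (\<forall>x\<in>set \<pi>. x \<le> (k::nat))}"
  by (rule finite_subset[OF _ finite_lists_length_le[of "{..k}" l]]) auto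

lemma graphic_le:
  assumes "graphic \<pi>" "x \<in> set \<pi>" shows "x < length \<pi>"
  using graphic_hd_less[OF assms(1)] le_hd_partition[of \<pi> x] assms
  by (cases \<pi>) (auto simp: graphic_def)

lemma finite_graphic: "finite {\<pi>. graphic \<pi> \<and> length \<pi> \<le> n}"
  by (rule finite_subset[OF _ finite_box[of n n]])
    (use graphic_le in \<open>fastforce intro: less_imp_le less_le_trans\<close>)

section \<open>Removing the outer hook\<close>

text \<open>
  Puts a new first row of length \<open>k\<close> and a new first column of length \<open>l\<close> around a diagram.
\<close>

definition hook :: "nat \<Rightarrow> nat \<Rightarrow> nat list \<Rightarrow> nat list" where
  "hook k l \<pi> = k # map Suc \<pi> @ replicate (l - 1 - length \<pi>) 1"

definition boxed :: "nat \<Rightarrow> nat \<Rightarrow> nat list \<Rightarrow> bool" where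
  "boxed k l \<pi> \<longleftrightarrow> is_partition \<pi> \<and> length \<pi> \<le> l \<and> (\<forall>x\<in>set \<pi>. x \<le> k)"

lemma finite_boxed: "finite {\<pi>. boxed k l \<pi>}"
  by (rule finite_subset[OF _ finite_box[of l k]]) (auto simp: boxed_def)

lemma inj_hook: "inj_on (hook k l) {\<pi>. is_partition \<pi>}"
proof (rule inj_onI)
  fix \<pi> \<rho> assume p: "\<pi> \<in> {\<pi>. is_partition \<pi>}" "\<rho> \<in> {\<pi>. is_partition \<pi>}" and eq: "hook k l \<pi> = hook k l \<rho>"
  have "filter ((<) 1) (map Suc \<sigma> @ replicate c 1) = map Suc \<sigma>" if "is_partition \<sigma>" for \<sigma> c
  proof -
    have "filter ((<) 1) (map Suc \<sigma>) = map Suc \<sigma>" using that by (simp add: is_partition_def)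
    then show ?thesis by simp
  qed
  then have "map Suc \<pi> = map Suc \<rho>" using p eq unfolding hook_def by (metis list.inject mem_Collect_eq)
  then show "\<pi> = \<rho>" by (simp add: inj_map_eq_map)
qed

lemma length_hook: "1 \<le> l \<Longrightarrow> length \<pi> \<le> l - 1 \<Longrightarrow> length (hook k l \<pi>) = l"
  by (simp add: hook_def)

lemma sum_list_hook:
  assumes "1 \<le> l" "length \<pi> \<le> l - 1"
  shows "int (sum_list (hook k l \<pi>)) = int (sum_list \<pi>) + int k + int l - 1"
proof -
  have "sum_list (map Suc \<pi>) = sum_list \<pi> + length \<pi>" by (induction \<pi>) simp_all
  then show ?thesis using assms by (simp add: hook_def sum_list_replicate)
qed

lemma partition_hook:
  assumes "boxed (k - 1) (l - 1) \<pi>" "1 \<le> k"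
  shows "is_partition (hook k l \<pi>)"
proof -
  have "sorted_wrt (\<ge>) (map Suc \<pi>)" using assms by (simp add: boxed_def is_partition_def sorted_wrt_map)
  moreover have "sorted_wrt (\<ge>) (replicate c (1::nat))" for c by (induction c) auto
  moreover have "Suc x \<le> k" if "x \<in> set \<pi>" for x using assms that by (fastforce simp: boxed_def)
  ultimately show ?thesis using assms(2) by (auto simp: hook_def is_partition_def sorted_wrt_append)
qed

text \<open>
  Removing the first row and subtracting one from the other parts leaves the parts that were larger
  than one.
\<close>

lemma hook_surj:
  assumes p: "is_partition \<rho>" and len: "length \<rho> = l" "1 \<le> l" and hd: "hd \<rho> = k"
  shows "\<exists>\<pi>. boxed (k - 1) (l - 1) \<pi> \<and> \<rho> = hook k l \<pi>"
proof -
  obtain xs where \<rho>: "\<rho> = k # xs" using len hd by (cases \<rho>) auto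
  have pos: "\<forall>x\<in>set xs. 1 \<le> x \<and> x \<le> k" and sorted: "sorted_wrt (\<ge>) xs"
    using p by (auto simp: \<rho> is_partition_def Suc_le_eq)
  define ys where "ys = map (\<lambda>x. x - 1) xs"
  have "map Suc ys = xs" unfolding ys_def map_map by (rule map_idI) (use pos in auto)
  have ys: "sorted_wrt (\<ge>) ys" unfolding ys_def sorted_wrt_map
    by (rule sorted_wrt_mono_rel[OF _ sorted]) auto
  define \<pi> where "\<pi> = filter ((<) 0) ys"
  have "length ys = l - 1" using len \<rho> by (simp add: ys_def)
  then have split: "ys = \<pi> @ replicate (l - 1 - length \<pi>) 0"
    using sorted_split_zeros[OF ys, symmetric] unfolding \<pi>_def by simp
  have "xs = map Suc \<pi> @ replicate (l - 1 - length \<pi>) 1"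
    unfolding \<open>map Suc ys = xs\<close>[symmetric] by (subst split) simp
  moreover have "length \<pi> \<le> l - 1" using \<open>length ys = l - 1\<close> unfolding \<pi>_def
    by (metis length_filter_le)
  moreover have "is_partition \<pi>" using ys by (simp add: \<pi>_def is_partition_def sorted_wrt_filter)
  moreover have "\<forall>x\<in>set \<pi>. x \<le> k - 1" using pos by (auto simp: \<pi>_def ys_def)
  ultimately show ?thesis unfolding boxed_def by (intro exI[of _ \<pi>]) (simp add: \<rho> hook_def)
qed

lemma part_hook_0: "part (hook k l \<pi>) 0 = k"
  by (simp add: part_def hook_def)

lemma part_hook_Suc:
  assumes "length \<pi> \<le> l - 1"
  shows "part (hook k l \<pi>) (Suc i) = (if i < l - 1 then Suc (part \<pi> i) else 0)"
  using assms by (auto simp: part_def hook_def nth_append)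

text \<open>
  The Durfee square grows by one row, the new first rank is \<open>l - k\<close>, and the old ranks move down by
  one place, since row and column through a diagonal cell are both extended by one dot. The condition at
  the first cell is the nonnegativity of the new \<open>s\<close>.
\<close>

lemma rank_ok_hook:
  assumes b: "boxed (k - 1) (l - 1) \<pi>" and k: "1 \<le> k" and l: "1 \<le> l"
  shows "rank_ok s (hook k l \<pi>) \<longleftrightarrow> 0 \<le> s + int l - int k - 1 \<and> rank_ok (s + int l - int k - 1) \<pi>"
proof -
  let ?h = "hook k l \<pi>"
  have p: "is_partition \<pi>" and len: "length \<pi> \<le> l - 1" using b by (auto simp: boxed_def)
  have pk: "part \<pi> i \<le> k - 1" for i by (rule part_le) (use b in \<open>auto simp: boxed_def\<close>)
  have ph: "is_partition ?h" by (rule partition_hook[OF b k])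
  have lh: "length ?h = l" using length_hook[OF l len] .
  have diag1: "(1, 1) \<in> ferrers ?h" using ferrers_Suc[of 0 0 ?h] k by (simp add: part_hook_0)
  have rk1: "rk ?h 1 = int l - int k"
    using row_Suc[of ?h 0] col_Suc[of ?h 0] by (simp add: rk_def part_hook_0 part_pos[OF ph] lh)
  have inl: "i < l - 1" if "j < part \<pi> i" for i j
    using that len part_pos[OF p, of i] by simp
  have diag: "(Suc j, Suc j) \<in> ferrers ?h \<longleftrightarrow> (j, j) \<in> ferrers \<pi>" if j: "1 \<le> j" for j
  proof -
    obtain a where "j = Suc a" using j by (cases j) auto
    then show ?thesis using inl[of a a] by (auto simp: ferrers_Suc part_hook_Suc[OF len])
  qed
  have rk: "rk ?h (Suc i) = rk \<pi> i" if i: "1 \<le> i" "(i, i) \<in> ferrers \<pi>" for i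
  proof -
    obtain a where a: "i = Suc a" using i by (cases i) auto
    then have aa: "a < part \<pi> a" using i by (simp add: ferrers_Suc)
    have al: "a < l - 1" and ak: "Suc a < k" using inl[OF aa] aa pk[of a] k by auto
    have "{x. Suc a < part ?h x} = insert 0 (Suc ` {x. a < part \<pi> x})"
    proof (rule set_eqI)
      fix x show "x \<in> {x. Suc a < part ?h x} \<longleftrightarrow> x \<in> insert 0 (Suc ` {x. a < part \<pi> x})"
        using ak inl[of a] by (cases x) (auto simp: part_hook_0 part_hook_Suc[OF len])
    qed
    moreover have "finite {x. a < part \<pi> x}"
      by (rule finite_subset[of _ "{..<l - 1}"]) (use inl in auto)
    ultimately have "col ?h (Suc i) = Suc (col \<pi> i)"
      by (simp add: a col_Suc card_image)
    moreover have "row ?h (Suc i) = Suc (row \<pi> i)"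
      using al by (simp add: a row_Suc part_hook_Suc[OF len])
    ultimately show ?thesis by (simp add: rk_def)
  qed
  have sum: "(\<Sum>i=1..Suc j. rk ?h i) = int l - int k + (\<Sum>i=1..j. rk \<pi> i)"
    if "1 \<le> j" "(j, j) \<in> ferrers \<pi>" for j
  proof -
    have "(\<Sum>i=1..Suc j. rk ?h i) = rk ?h 1 + (\<Sum>i=Suc 1..Suc j. rk ?h i)"
      by (rule sum.atLeast_Suc_atMost) simp
    also have "(\<Sum>i=Suc 1..Suc j. rk ?h i) = (\<Sum>i=1..j. rk ?h (Suc i))"
      by (rule sum.shift_bounds_cl_Suc_ivl)
    also have "\<dots> = (\<Sum>i=1..j. rk \<pi> i)"
      by (rule sum.cong) (use rk diagonal_down[OF p _ _ that(2)] in auto)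
    finally show ?thesis using rk1 by simp
  qed
  show ?thesis
  proof
    assume h: "rank_ok s ?h"
    have "int 1 \<le> s + (\<Sum>i=1..1. rk ?h i)"
      using h diag1 unfolding rank_ok_def by blast
    then have "0 \<le> s + int l - int k - 1" using rk1 by simp
    moreover have "int j \<le> s + int l - int k - 1 + (\<Sum>i=1..j. rk \<pi> i)"
      if "1 \<le> j" "(j, j) \<in> ferrers \<pi>" for j
    proof -
      have "int (Suc j) \<le> s + (\<Sum>i=1..Suc j. rk ?h i)"
        using h diag[OF that(1)] that unfolding rank_ok_def by (meson le_SucI)
      then show ?thesis using sum[OF that] by simp
    qed
    ultimately show "0 \<le> s + int l - int k - 1 \<and> rank_ok (s + int l - int k - 1) \<pi>"
      by (simp add: rank_ok_def)
  next
    assume h: "0 \<le> s + int l - int k - 1 \<and> rank_ok (s + int l - int k - 1) \<pi>"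
    show "rank_ok s ?h"
      unfolding rank_ok_def
    proof (intro allI impI)
      fix j assume j: "1 \<le> j" "(j, j) \<in> ferrers ?h"
      show "int j \<le> s + (\<Sum>i=1..j. rk ?h i)"
      proof (cases "j = 1")
        case True
        then show ?thesis using h rk1 by simp
      next
        case False
        then obtain a where a: "j = Suc a" "1 \<le> a" using j(1) by (cases j) auto
        then have aa: "(a, a) \<in> ferrers \<pi>" using j(2) diag[of a] by simp
        then have "int a \<le> s + int l - int k - 1 + (\<Sum>i=1..a. rk \<pi> i)"
          using h a by (auto simp: rank_ok_def)
        then show ?thesis using sum[OF a(2) aa] a by simp
      qed
    qed
  qed
qed

text \<open>
  The predicate \<open>R\<close> stands for the condition on the size: a prescribed value in \<^const>\<open>Lam\<close>, a
  prescribed parity in the recurrence.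
\<close>

lemma hook_image:
  assumes "1 \<le> k" "1 \<le> l" "u = s + int l - int k - 1"
  shows "{\<rho>. is_partition \<rho> \<and> length \<rho> = l \<and> hd \<rho> = k \<and> rank_ok s \<rho> \<and> R (int (sum_list \<rho>))}
    = hook k l ` {\<pi>. boxed (k - 1) (l - 1) \<pi> \<and> 0 \<le> u \<and> rank_ok u \<pi> \<and> R (int (sum_list \<pi>) + int k + int l - 1)}"
    (is "?L = hook k l ` ?X")
proof (intro set_eqI iffI)
  fix \<rho> assume r: "\<rho> \<in> ?L"
  then obtain \<pi> where b: "boxed (k - 1) (l - 1) \<pi>" and eq: "\<rho> = hook k l \<pi>"
    using hook_surj[of \<rho> l k] assms by auto
  have len: "length \<pi> \<le> l - 1" using b by (simp add: boxed_def)
  have "\<pi> \<in> ?X"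
    using r b rank_ok_hook[OF b assms(1,2), of s] sum_list_hook[OF assms(2) len, of k]
    unfolding eq assms(3) by simp
  then show "\<rho> \<in> hook k l ` ?X" using eq by blast
next
  fix \<rho> assume "\<rho> \<in> hook k l ` ?X"
  then obtain \<pi> where x: "\<pi> \<in> ?X" and eq: "\<rho> = hook k l \<pi>" by auto
  then have b: "boxed (k - 1) (l - 1) \<pi>" by simp
  have len: "length \<pi> \<le> l - 1" using b by (simp add: boxed_def)
  have "hd \<rho> = k" by (simp add: eq hook_def)
  then show "\<rho> \<in> ?L"
    using x rank_ok_hook[OF b assms(1,2), of s] sum_list_hook[OF assms(2) len, of k]
      length_hook[OF assms(2) len, of k] partition_hook[OF b assms(1)]
    unfolding eq assms(3) by simp
qed

lemma card_hook:
  assumes "1 \<le> k" "1 \<le> l" "u = s + int l - int k - 1"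
  shows "card {\<rho>. is_partition \<rho> \<and> length \<rho> = l \<and> hd \<rho> = k \<and> rank_ok s \<rho> \<and> R (int (sum_list \<rho>))}
    = card {\<pi>. boxed (k - 1) (l - 1) \<pi> \<and> 0 \<le> u \<and> rank_ok u \<pi> \<and> R (int (sum_list \<pi>) + int k + int l - 1)}"
  unfolding hook_image[OF assms, of R]
proof (rule card_image, rule inj_on_subset[OF inj_hook])
  show "{\<pi>. boxed (k - 1) (l - 1) \<pi> \<and> 0 \<le> u \<and> rank_ok u \<pi> \<and> R (int (sum_list \<pi>) + int k + int l - 1)}
      \<subseteq> {\<pi>. is_partition \<pi>}"
    unfolding boxed_def by blast
qed

lemma P4_eq:
  "P4 N (int k) (int l) s = {\<pi>. boxed k l \<pi> \<and> 0 \<le> s \<and> rank_ok s \<pi> \<and> int (sum_list \<pi>) = N}"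
proof (rule set_eqI)
  fix \<pi>
  show "\<pi> \<in> P4 N (int k) (int l) s \<longleftrightarrow>
      \<pi> \<in> {\<pi>. boxed k l \<pi> \<and> 0 \<le> s \<and> rank_ok s \<pi> \<and> int (sum_list \<pi>) = N}"
  proof (cases "is_partition \<pi>")
    case True
    then show ?thesis using rank_ok_durfee[OF True, of s] by (auto simp: P4_def P3_def boxed_def)
  next
    case False
    then show ?thesis by (auto simp: P4_def P3_def boxed_def)
  qed
qed

section \<open>The recurrence\<close>

text \<open>
  Removing a hook with \<open>k + l - 1\<close> dots changes \<open>s\<close> by \<open>l - k - 1\<close>, which has the same parity. The
  parity of \<open>|\<pi>| + s\<close> is therefore invariant, and evenness of the degree sum can be enforced without
  keeping the size as a parameter of the recurrence.
\<close>

definition ranked_box :: "nat \<Rightarrow> nat \<Rightarrow> int \<Rightarrow> nat list set" where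
  "ranked_box k l s = {\<pi>. boxed k l \<pi> \<and> 0 \<le> s \<and> rank_ok s \<pi> \<and> even (int (sum_list \<pi>) + s)}"

lemma finite_ranked_box: "finite (ranked_box k l s)"
  by (rule finite_subset[OF _ finite_boxed[of k l]]) (auto simp: ranked_box_def)

lemma ranked_box_base:
  assumes "k = 0 \<or> l = 0" "0 \<le> s"
  shows "card (ranked_box k l s) = (if even s then 1 else 0)"
proof -
  have box: "boxed k l \<pi> \<longleftrightarrow> \<pi> = []" for \<pi>
    using assms by (cases \<pi>) (auto simp: boxed_def is_partition_def)
  have ok: "rank_ok s []" by (auto simp: rank_ok_def ferrers_def)
  have "ranked_box k l s = {\<pi>. \<pi> = [] \<and> even s}"
    unfolding ranked_box_def box by (rule Collect_cong) (use ok assms(2) in auto)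
  then show ?thesis by simp
qed

text \<open>
  Partitions in the larger box miss the last row, or miss the last column, or fill both; the first two
  cases are counted by inclusion and exclusion, the third by hook removal.
\<close>

lemma ranked_box_rec:
  assumes "0 \<le> s"
  shows "int (card (ranked_box (Suc k) (Suc l) s)) =
    int (card (ranked_box (Suc k) l s)) + int (card (ranked_box k (Suc l) s)) - int (card (ranked_box k l s))
    + int (card (ranked_box k l (s + int l - int k - 1)))"
proof -
  let ?u = "s + int l - int k - 1"
  let ?H = "{\<rho>. is_partition \<rho> \<and> length \<rho> = Suc l \<and> hd \<rho> = Suc k \<and> rank_ok s \<rho> \<and> even (int (sum_list \<rho>) + s)}"
  have hd: "(\<forall>x\<in>set \<pi>. x \<le> j) \<longleftrightarrow> \<pi> = [] \<or> hd \<pi> \<le> j" if "is_partition \<pi>" for \<pi> j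
    using le_hd_partition[OF that] by (cases \<pi>) (auto intro: le_trans)
  have box: "boxed j m \<pi> \<longleftrightarrow> is_partition \<pi> \<and> length \<pi> \<le> m \<and> (\<pi> = [] \<or> hd \<pi> \<le> j)" for j m \<pi>
    using hd by (auto simp: boxed_def)
  have un: "ranked_box (Suc k) (Suc l) s = (ranked_box (Suc k) l s \<union> ranked_box k (Suc l) s) \<union> ?H"
    using assms by (auto simp: ranked_box_def box le_Suc_eq)
  have disj: "(ranked_box (Suc k) l s \<union> ranked_box k (Suc l) s) \<inter> ?H = {}"
    by (auto simp: ranked_box_def box)
  have inter: "ranked_box (Suc k) l s \<inter> ranked_box k (Suc l) s = ranked_box k l s"
    by (auto simp: ranked_box_def box)
  have par: "even (x + int (Suc k) + int (Suc l) - 1 + s) \<longleftrightarrow> even (x + ?u)" for x by presburger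
  have "card ?H = card {\<pi>. boxed k l \<pi> \<and> 0 \<le> ?u \<and> rank_ok ?u \<pi> \<and> even (int (sum_list \<pi>) + int (Suc k) + int (Suc l) - 1 + s)}"
    using card_hook[of "Suc k" "Suc l" ?u s "\<lambda>x. even (x + s)"] by (simp add: algebra_simps)
  also have "{\<pi>. boxed k l \<pi> \<and> 0 \<le> ?u \<and> rank_ok ?u \<pi> \<and> even (int (sum_list \<pi>) + int (Suc k) + int (Suc l) - 1 + s)} = ranked_box k l ?u"
    unfolding ranked_box_def par by blast
  finally have H: "card ?H = card (ranked_box k l ?u)" .
  have finH: "finite ?H" by (rule finite_subset[OF _ finite_ranked_box[of "Suc k" "Suc l" s]]) (use un in blast)
  have "card (ranked_box (Suc k) (Suc l) s) = card (ranked_box (Suc k) l s \<union> ranked_box k (Suc l) s) + card ?H"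
    unfolding un by (rule card_Un_disjoint) (use finite_ranked_box finH disj in auto)
  moreover have "card (ranked_box (Suc k) l s) + card (ranked_box k (Suc l) s) = card (ranked_box (Suc k) l s \<union> ranked_box k (Suc l) s) + card (ranked_box k l s)"
    using card_Un_Int[OF finite_ranked_box finite_ranked_box, of "Suc k" l s k "Suc l" s] inter by simp
  ultimately show ?thesis using H by simp
qed

lemma ranked_box_graphic: "ranked_box n n 0 = {\<pi>. graphic \<pi> \<and> length \<pi> \<le> n}"
proof -
  have "boxed n n \<pi>" if "graphic \<pi>" "length \<pi> \<le> n" for \<pi>
    using graphic_le[OF that(1)] that by (fastforce simp: boxed_def graphic_def)
  then show ?thesis by (auto simp: ranked_box_def boxed_def graphic_def)
qed

lemma card_D_ranked_box:
  assumes "1 \<le> n"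
  shows "int (card (D n)) = int (card (ranked_box n n 0)) - int (card (ranked_box (n - 1) (n - 1) 0))"
proof -
  have "ranked_box n n 0 = ranked_box (n - 1) (n - 1) 0 \<union> {\<pi>. graphic \<pi> \<and> length \<pi> = n}"
    using assms by (auto simp: ranked_box_graphic)
  moreover have "card (ranked_box (n - 1) (n - 1) 0 \<union> {\<pi>. graphic \<pi> \<and> length \<pi> = n})
      = card (ranked_box (n - 1) (n - 1) 0) + card {\<pi>. graphic \<pi> \<and> length \<pi> = n}"
  proof (rule card_Un_disjoint)
    show "finite {\<pi>. graphic \<pi> \<and> length \<pi> = n}"
      by (rule finite_subset[OF _ finite_graphic[of n]]) auto
      show "finite (ranked_box (n - 1) (n - 1) 0)" by (rule finite_ranked_box)
  qed (use assms in \<open>auto simp: ranked_box_graphic\<close>)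
  ultimately show ?thesis by (simp add: card_D)
qed

section \<open>Counting by the sum of the degrees\<close>

text \<open>
  Otherwise the simplifier moves coercions into the multiset and hides the sum of the degrees.
\<close>

declare of_nat_sum_mset [simp del]

definition complement :: "nat \<Rightarrow> nat multiset \<Rightarrow> nat multiset" where
  "complement n d = image_mset (\<lambda>x. n - 1 - x) d"

lemma D0_le: "d \<in> D0 n \<Longrightarrow> x \<in># d \<Longrightarrow> x \<le> n - 1"
proof -
  assume d: "d \<in> D0 n" "x \<in># d"
  then obtain \<pi> where g: "graphic \<pi>" "length \<pi> \<le> n" and eq: "d = pad n \<pi>" by (auto simp: D0_eq)
  have "x \<in> set \<pi> \<or> x = 0" using d by (auto simp: eq pad_def split: if_splits)
  then show "x \<le> n - 1" using graphic_le[OF g(1), of x] g(2) by auto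
qed

text \<open>
  A vertex of degree 0 excludes a vertex of degree \<open>n - 1\<close>.
\<close>

lemma D0_zero_le: "d \<in> D0 n \<Longrightarrow> 0 \<in># d \<Longrightarrow> x \<in># d \<Longrightarrow> x \<le> n - 2"
proof -
  assume d: "d \<in> D0 n" "0 \<in># d" "x \<in># d"
  then obtain \<pi> where g: "graphic \<pi>" and eq: "d = pad n \<pi>" by (auto simp: D0_eq)
  have "length \<pi> < n" using d zero_in_pad[of \<pi> n] g by (simp add: eq graphic_def)
  moreover have "x \<in> set \<pi> \<or> x = 0" using d by (auto simp: eq pad_def split: if_splits)
  ultimately show "x \<le> n - 2" using graphic_le[OF g, of x] by auto
qed

lemma D0_size: "d \<in> D0 n \<Longrightarrow> size d = n"
  by (auto simp: D0_eq pad_def)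

lemma complement_D0:
  assumes "d \<in> D0 n"
  shows "complement n d \<in> D0 n"
proof -
  obtain V E where G: "simple_graph V E" and n: "card V = n" and d: "d = degree_sequence V E"
    using assms by (auto simp: D0_def)
  let ?E = "{e. e \<subseteq> V \<and> card e = 2} - E"
  have fin: "finite V" using G by (simp add: simple_graph_def)
  have "degree_sequence V ?E = image_mset (\<lambda>v. n - 1 - degree E v) (mset_set V)"
    unfolding degree_sequence_def
    by (rule image_mset_cong) (use degree_complement[OF G] fin n in auto)
  then have "complement n d = degree_sequence V ?E"
    by (simp add: complement_def d degree_sequence_def multiset.map_comp comp_def)
  moreover have "simple_graph V ?E" using fin by (auto simp: simple_graph_def)
  ultimately show ?thesis using n unfolding D0_def by blast
qed

lemma complement_complement:
  assumes "d \<in> D0 n"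
  shows "complement n (complement n d) = d"
proof -
  have "image_mset ((\<lambda>x. n - 1 - x) \<circ> (\<lambda>x. n - 1 - x)) d = image_mset id d"
  proof (rule image_mset_cong)
    fix x assume "x \<in># d"
    then show "((\<lambda>x. n - 1 - x) \<circ> (\<lambda>x. n - 1 - x)) x = id x"
      using D0_le[OF assms, of x] by simp
  qed
  then show ?thesis by (simp add: complement_def multiset.map_comp)
qed

lemma sum_complement:
  assumes "d \<in> D0 n" "1 \<le> n"
  shows "int (\<Sum>\<^sub># (complement n d)) = int n * (int n - 1) - int (\<Sum>\<^sub># d)"
proof -
  have "\<Sum>\<^sub># (image_mset (\<lambda>x. n - 1 - x) d) + \<Sum>\<^sub># d = size d * (n - 1)"
    if "\<forall>x\<in>#d. x \<le> n - 1" for d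
    using that by (induction d) auto
  then have "\<Sum>\<^sub># (complement n d) + \<Sum>\<^sub># d = n * (n - 1)"
    using D0_le[OF assms(1)] D0_size[OF assms(1)] unfolding complement_def by blast
  then have "int (\<Sum>\<^sub># (complement n d)) + int (\<Sum>\<^sub># d) = int n * int (n - 1)"
    by (metis of_nat_add of_nat_mult)
  then show ?thesis using assms(2) by (simp only: of_nat_diff of_nat_1)
qed

lemma finite_D0: "finite (D0 n)"
  unfolding D0_eq using finite_graphic by blast

text \<open>
  Complementation turns a vertex joined to all others into an isolated vertex, which can be deleted.
\<close>

lemma card_full_degree:
  assumes n: "2 \<le> n"
  shows "card {d \<in> D n. n - 1 \<in># d} = card (D0 (n - 1))"
proof -
  let ?Z = "{d \<in> D0 n. 0 \<in># d}"
  have DD: "d \<in> D n \<Longrightarrow> d \<in> D0 n" for d by (simp add: D_def)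
  have "bij_betw (complement n) {d \<in> D n. n - 1 \<in># d} ?Z"
  proof (rule bij_betw_byWitness[where f' = "complement n"])
    show "complement n ` {d \<in> D n. n - 1 \<in># d} \<subseteq> ?Z"
      using complement_D0 DD by (force simp: complement_def)
    show "complement n ` ?Z \<subseteq> {d \<in> D n. n - 1 \<in># d}"
    proof
      fix c assume "c \<in> complement n ` ?Z"
      then obtain d where d: "d \<in> D0 n" "0 \<in># d" and c: "c = complement n d" by auto
      have "1 \<le> n - 1 - x" if "x \<in># d" for x using D0_zero_le[OF d that] n by simp
      then have "c \<in> D n" using complement_D0[OF d(1)] by (auto simp: D_def c complement_def)
      moreover have "n - 1 \<in># c" using d(2) by (force simp: c complement_def)
      ultimately show "c \<in> {d \<in> D n. n - 1 \<in># d}" by simp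
    qed
  qed (use complement_complement DD in auto)
  then have "card {d \<in> D n. n - 1 \<in># d} = card ?Z" by (rule bij_betw_same_card)
  also have "?Z = pad n ` {\<pi>. graphic \<pi> \<and> length \<pi> \<le> n - 1}"
    using n zero_in_pad[of _ n] by (fastforce simp: D0_eq graphic_def)
  also have "card \<dots> = card (D0 (n - 1))"
    unfolding card_D0 by (rule card_pad) (simp add: graphic_def)
  finally show ?thesis .
qed

text \<open>
  The sequences whose terms avoid both 0 and \<open>n - 1\<close>. Complementation maps this set to itself and
  reflects the sum of the degrees at \<open>n (n - 1) / 2\<close>.
\<close>

definition mid :: "nat \<Rightarrow> nat multiset set" where
  "mid n = {d \<in> D n. n - 1 \<notin># d}"

definition mid_sum :: "nat \<Rightarrow> int \<Rightarrow> nat multiset set" where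
  "mid_sum n N = {d \<in> mid n. int (\<Sum>\<^sub># d) = N}"

lemma finite_mid: "finite (mid n)"
  by (rule finite_subset[OF _ finite_D0[of n]]) (auto simp: mid_def D_def)

lemma mid_complement: "2 \<le> n \<Longrightarrow> d \<in> mid n \<Longrightarrow> complement n d \<in> mid n"
proof -
  assume n: "2 \<le> n" and d: "d \<in> mid n"
  then have d0: "d \<in> D0 n" by (simp add: mid_def D_def)
  have x: "1 \<le> x \<and> x \<le> n - 2" if "x \<in># d" for x
    using d that D0_le[OF d0 that] by (cases "x = n - 1") (auto simp: mid_def D_def)
  then have "1 \<le> n - 1 - x \<and> n - 1 - x \<noteq> n - 1" if "x \<in># d" for x
    using x[OF that] n by linarith
  then show "complement n d \<in> mid n"
    using complement_D0[OF d0] by (force simp: mid_def D_def complement_def)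
qed

lemma card_mid_sum_reflect:
  assumes n: "2 \<le> n"
  shows "card (mid_sum n (int n * (int n - 1) - N)) = card (mid_sum n N)"
proof -
  have d0: "d \<in> mid n \<Longrightarrow> d \<in> D0 n" for d by (simp add: mid_def D_def)
  have "bij_betw (complement n) (mid_sum n N) (mid_sum n (int n * (int n - 1) - N))"
    by (rule bij_betw_byWitness[where f' = "complement n"])
      (use mid_complement[OF n] sum_complement[OF d0] n d0 complement_complement
        in \<open>auto simp: mid_sum_def\<close>)
  then show ?thesis by (metis bij_betw_same_card)
qed

lemma sum_even_D: "d \<in> D n \<Longrightarrow> even (\<Sum>\<^sub># d)"
  by (auto simp: D_eq pad_def graphic_def sum_mset_sum_list)

lemma sum_ge_D: "d \<in> D n \<Longrightarrow> n \<le> \<Sum>\<^sub># d"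
proof -
  assume d: "d \<in> D n"
  have "size d \<le> \<Sum>\<^sub># d" if "\<forall>x\<in>#d. 1 \<le> x" for d :: "nat multiset"
    using that by (induction d) auto
  then have "size d \<le> \<Sum>\<^sub># d" using d by (simp add: D_def)
  then show ?thesis using d D0_size[of d n] by (simp add: D_def)
qed

text \<open>
  A graphical partition with \<open>n\<close> parts and largest part \<open>k\<close> has an outer hook with \<open>k + n - 1\<close> dots;
  removing it leaves \<open>s = n - k - 1\<close>. This is the summand for \<open>k\<close> in \<^const>\<open>Lam\<close>.
\<close>

lemma Lam_eq:
  assumes n: "2 \<le> n" and N: "even N"
  shows "Lam N n = card (mid_sum n N)"
proof -
  define X where "X k = {\<rho>. is_partition \<rho> \<and> length \<rho> = n \<and> hd \<rho> = k \<and> rank_ok 0 \<rho> \<and> int (sum_list \<rho>) = N}" for k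
  have finX: "finite (X k)" for k
  proof (rule finite_subset[OF _ finite_box[of n k]])
    show "X k \<subseteq> {\<pi>. length \<pi> \<le> n \<and> (\<forall>x\<in>set \<pi>. x \<le> k)}"
      using le_hd_partition by (auto simp: X_def)
  qed
  have card: "card (P4 (N - int k - int n + 1) (int k - 1) (int n - 1) (int n - int k - 1)) = card (X k)"
    if k: "k \<in> {1..n-2}" for k
  proof -
    have "P4 (N - int k - int n + 1) (int k - 1) (int n - 1) (int n - int k - 1)
        = P4 (N - int k - int n + 1) (int (k - 1)) (int (n - 1)) (int n - int k - 1)"
      using k n by (simp add: of_nat_diff)
    also have "\<dots> = {\<pi>. boxed (k - 1) (n - 1) \<pi> \<and> 0 \<le> int n - int k - 1 \<and> rank_ok (int n - int k - 1) \<pi>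
        \<and> int (sum_list \<pi>) + int k + int n - 1 = N}"
      unfolding P4_eq by auto
    also have "card \<dots> = card (X k)"
      unfolding X_def using card_hook[of k n "int n - int k - 1" 0 "\<lambda>x. x = N"] k n by simp
    finally show ?thesis .
  qed
  have "Lam N n = (\<Sum>k\<in>int ` {1..n-2}. card (P4 (N - k - int n + 1) (k - 1) (int n - 1) (int n - k - 1)))"
    unfolding Lam_def using n by (simp add: image_int_atLeastAtMost of_nat_diff)
  also have "\<dots> = (\<Sum>k\<in>{1..n-2}. card (X k))"
    by (subst sum.reindex) (auto intro!: sum.cong card simp: inj_on_def)
  also have "\<dots> = card (\<Union>k\<in>{1..n-2}. X k)"
    by (rule card_UN_disjoint[symmetric]) (use finX in \<open>auto simp: X_def\<close>)
  also have "\<dots> = card (pad n ` (\<Union>k\<in>{1..n-2}. X k))"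
    by (rule card_pad[symmetric]) (auto simp: X_def)
  also have "pad n ` (\<Union>k\<in>{1..n-2}. X k) = mid_sum n N"
  proof -
    have pad: "pad n \<rho> = mset \<rho>" if "length \<rho> = n" for \<rho> using that by (simp add: pad_def)
    have "(\<Union>k\<in>{1..n-2}. X k) = {\<rho>. graphic \<rho> \<and> length \<rho> = n \<and> n - 1 \<notin> set \<rho> \<and> int (sum_list \<rho>) = N}"
    proof (rule set_eqI)
      fix \<rho>
      show "\<rho> \<in> (\<Union>k\<in>{1..n-2}. X k) \<longleftrightarrow> \<rho> \<in> {\<rho>. graphic \<rho> \<and> length \<rho> = n \<and> n - 1 \<notin> set \<rho> \<and> int (sum_list \<rho>) = N}"
      proof
        assume "\<rho> \<in> (\<Union>k\<in>{1..n-2}. X k)"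
        then have r: "\<rho> \<in> X (hd \<rho>)" "hd \<rho> \<in> {1..n-2}" by (auto simp: X_def)
        then have "n - 1 \<notin> set \<rho>" using le_hd_partition[of \<rho> "n - 1"] n by (auto simp: X_def)
        moreover have "even (sum_list \<rho>)" using r N by (auto simp: X_def)
        ultimately show "\<rho> \<in> {\<rho>. graphic \<rho> \<and> length \<rho> = n \<and> n - 1 \<notin> set \<rho> \<and> int (sum_list \<rho>) = N}"
          using r by (auto simp: X_def graphic_def)
      next
        assume r: "\<rho> \<in> {\<rho>. graphic \<rho> \<and> length \<rho> = n \<and> n - 1 \<notin> set \<rho> \<and> int (sum_list \<rho>) = N}"
        then have hd: "hd \<rho> \<in> set \<rho>" using n by (cases \<rho>) auto
        have "0 < hd \<rho>" using r hd by (auto simp: graphic_def is_partition_def)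
        moreover have "hd \<rho> < n" using graphic_le[of \<rho>] r hd by auto
        moreover have "hd \<rho> \<noteq> n - 1" using r hd by auto
        ultimately have "hd \<rho> \<in> {1..n-2}" by auto
        moreover have "\<rho> \<in> X (hd \<rho>)" using r by (auto simp: X_def graphic_def)
        ultimately show "\<rho> \<in> (\<Union>k\<in>{1..n-2}. X k)" by blast
      qed
    qed
    moreover have "pad n ` {\<rho>. graphic \<rho> \<and> length \<rho> = n \<and> n - 1 \<notin> set \<rho> \<and> int (sum_list \<rho>) = N} = mid_sum n N"
      by (auto simp: mid_sum_def mid_def D_eq pad sum_mset_sum_list)
    ultimately show ?thesis by simp
  qed
  finally show ?thesis .
qed

lemma card_D_by_sum:
  assumes n: "2 \<le> n"
  shows "card (D n) =
      card (D0 (n - 1)) + 2 * (\<Sum>N\<in>J'e n. Lam N n) + (if even (M_of n) then 1 else 0) * Lam (M_of n) n"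
proof -
  let ?T = "int n * (int n - 1)" let ?M = "M_of n"
  have M: "2 * ?M = ?T" by (simp add: M_of_def)
  have Teven: "even ?T" by simp
  define c where "c = (\<lambda>N. card (mid_sum n N))"
  let ?J = "J'e n" let ?J2 = "(\<lambda>N. ?T - N) ` J'e n" let ?J1 = "if even ?M then {?M} else {}"
  have finJ: "finite ?J" by (rule finite_subset[of _ "{int n..?M}"]) (auto simp: J'e_def)
  have Jlt: "N < ?M" if "N \<in> ?J" for N using that by (simp add: J'e_def)
  have cover: "int (\<Sum>\<^sub># d) \<in> ?J \<union> ?J1 \<union> ?J2" if d: "d \<in> mid n" for d
  proof -
    let ?N = "int (\<Sum>\<^sub># d)"
    have dD: "d \<in> D n" "complement n d \<in> D n" using d mid_complement[OF n d] by (auto simp: mid_def)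
    have d0: "d \<in> D0 n" using dD by (simp add: D_def)
    have ev: "even ?N" using sum_even_D[OF dD(1)] by (simp only: even_of_nat)
    have ge: "int n \<le> ?N" using sum_ge_D[OF dD(1)] by (simp only: of_nat_le_iff)
    have ge2: "int n \<le> ?T - ?N" using sum_ge_D[OF dD(2)] sum_complement[OF d0] n by linarith
    consider "?N < ?M" | "?N = ?M" | "?M < ?N" by linarith
    then show ?thesis
    proof cases
      case 3
      then have "?T - ?N \<in> ?J" using M ev ge2 by (simp add: J'e_def)
      then have "?T - (?T - ?N) \<in> ?J2" by blast
      then show ?thesis by simp
    qed (use ev ge in \<open>auto simp: J'e_def\<close>)
  qed
  have "card (D n) = card {d \<in> D n. n - 1 \<in># d} + card (mid n)"
  proof -
    have "finite (D n)" by (rule finite_subset[OF _ finite_D0[of n]]) (auto simp: D_def)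
    moreover have "D n = {d \<in> D n. n - 1 \<in># d} \<union> mid n" by (auto simp: mid_def)
    ultimately show ?thesis
      by (metis (no_types, lifting) card_Un_disjoint finite_Un disjoint_iff mem_Collect_eq mid_def)
  qed
  also have "card (mid n) = (\<Sum>N\<in>?J \<union> ?J1 \<union> ?J2. c N)"
  proof -
    have "mid n = (\<Union>N\<in>?J \<union> ?J1 \<union> ?J2. mid_sum n N)"
      using cover unfolding mid_sum_def by blast
    moreover have "card (\<Union>N\<in>?J \<union> ?J1 \<union> ?J2. mid_sum n N) = (\<Sum>N\<in>?J \<union> ?J1 \<union> ?J2. c N)"
      unfolding c_def
    proof (rule card_UN_disjoint)
      show "\<forall>N\<in>?J \<union> ?J1 \<union> ?J2. finite (mid_sum n N)"
        using finite_mid by (simp add: mid_sum_def)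
    qed (use finJ in \<open>auto simp: mid_sum_def\<close>)
    ultimately show ?thesis by simp
  qed
  also have "\<dots> = (\<Sum>N\<in>?J. c N) + (\<Sum>N\<in>?J1. c N) + (\<Sum>N\<in>?J2. c N)"
  proof -
    have "N \<le> ?M" if "N \<in> ?J \<union> ?J1" for N
      using that Jlt[of N] by (auto split: if_splits)
    moreover have "?M < N" if N: "N \<in> ?J2" for N
    proof -
      obtain K where "K \<in> ?J" "N = ?T - K" using N by blast
      then show ?thesis using Jlt[of K] M by linarith
    qed
    ultimately have "(?J \<union> ?J1) \<inter> ?J2 = {}" by fastforce
    moreover have "?J \<inter> ?J1 = {}" using Jlt by auto
    ultimately show ?thesis using finJ by (simp add: sum.union_disjoint)
  qed
  also have "(\<Sum>N\<in>?J2. c N) = (\<Sum>N\<in>?J. c N)"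
    by (subst sum.reindex) (simp_all add: inj_on_def c_def card_mid_sum_reflect[OF n])
  also have "(\<Sum>N\<in>?J. c N) = (\<Sum>N\<in>?J. Lam N n)"
    by (rule sum.cong) (simp_all add: c_def J'e_def Lam_eq[OF n])
  also have "(\<Sum>N\<in>?J1. c N) = (if even ?M then 1 else 0) * Lam ?M n"
    by (simp add: c_def Lam_eq[OF n])
  finally show ?thesis using card_full_degree[OF n] by simp
qed

section \<open>Hoare triples with time bounds\<close>

text \<open>
  Total correctness with an upper bound on the time. An upper bound, in place of the exact time,
  allows one bound for both branches of a conditional and for all passes through a loop.
\<close>

definition triple :: "(state \<Rightarrow> bool) \<Rightarrow> com \<Rightarrow> nat \<Rightarrow> (state \<Rightarrow> bool) \<Rightarrow> bool" where
  "triple P c t Q \<longleftrightarrow> (\<forall>s. P s \<longrightarrow> (\<exists>t' s'. exec c s t' s' \<and> t' \<le> t \<and> Q s'))"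

lemma triple_conseq:
  assumes "triple P' c t' R" "\<And>s. P s \<Longrightarrow> P' s" "t' \<le> t"
  shows "triple P c t R"
  using assms unfolding triple_def by (meson le_trans)

lemma triple_Assign:
  "triple (\<lambda>s. Q (s\<lparr>vars := (vars s)(x := aval a (vars s))\<rparr>)) (Assign x a) (1 + acost a) Q"
  unfolding triple_def using exec.Assign by blast

lemma triple_Load:
  "triple (\<lambda>s. \<exists>ds f. arrs s A = Some (ds, f) \<and> in_bounds (avals is (vars s)) ds
        \<and> Q (s\<lparr>vars := (vars s)(x := f (avals is (vars s)))\<rparr>))
    (Load x A is) (2 + acosts is) Q"
  unfolding triple_def using exec.Load by blast

lemma triple_Store:
  "triple (\<lambda>s. \<exists>ds f. arrs s A = Some (ds, f) \<and> in_bounds (avals is (vars s)) ds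
        \<and> Q (s\<lparr>arrs := (arrs s)(A \<mapsto> (ds, f(avals is (vars s) := aval a (vars s))))\<rparr>))
    (Store A is a) (2 + acosts is + acost a) Q"
  unfolding triple_def using exec.Store by blast

lemma triple_New:
  "triple (\<lambda>s. arrs s A = None \<and> avals as (vars s) = map int ds \<and> Q (s\<lparr>arrs := (arrs s)(A \<mapsto> (ds, \<lambda>_. 0))\<rparr>))
    (New A as) (1 + acosts as + prod_list ds) Q"
  unfolding triple_def using exec.New by blast

lemma triple_Seq:
  assumes "triple R c2 t2 Q" "triple P c1 t1 R"
  shows "triple P (Seq c1 c2) (t1 + t2) Q"
  using assms unfolding triple_def by (meson exec.Seq add_mono)

lemma triple_Cond:
  assumes "triple P1 c1 t1 Q" "triple P2 c2 t2 Q"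
  shows "triple (\<lambda>s. if bval b (vars s) then P1 s else P2 s) (Cond b c1 c2) (bcost b + (t1 + t2)) Q"
  unfolding triple_def
proof (intro allI impI)
  fix s assume p: "if bval b (vars s) then P1 s else P2 s"
  show "\<exists>t' s'. exec (Cond b c1 c2) s t' s' \<and> t' \<le> bcost b + (t1 + t2) \<and> Q s'"
  proof (cases "bval b (vars s)")
    case True
    then obtain t' s' where "exec c1 s t' s'" "t' \<le> t1" "Q s'"
      using p assms(1) unfolding triple_def by fastforce
    then show ?thesis using exec.CondTrue[OF True] by (intro exI[of _ "bcost b + t'"] exI[of _ s']) auto
  next
    case False
    then obtain t' s' where "exec c2 s t' s'" "t' \<le> t2" "Q s'"
      using p assms(2) unfolding triple_def by fastforce
    then show ?thesis using exec.CondFalse[OF False] by (intro exI[of _ "bcost b + t'"] exI[of _ s']) auto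
  qed
qed

text \<open>
  The form used when the first program is already verified and the rest is straight-line code, whose
  weakest precondition \<open>R\<close> is found by unification.
\<close>

lemma triple_then:
  assumes "triple P c1 t1 R'" "triple R c2 t2 Q" "\<And>s. R' s \<Longrightarrow> R s" "t1 + t2 \<le> t"
  shows "triple P (Seq c1 c2) t Q"
proof -
  have "triple P c1 t1 R" using assms(1,3) unfolding triple_def by blast
  then show ?thesis by (rule triple_conseq[OF triple_Seq[OF assms(2)]]) (use assms(4) in auto)
qed

text \<open>
  Every loop below is a counting loop, so a family of invariants indexed by the number of completed
  passes takes the place of a variant.
\<close>

lemma triple_For:
  assumes body: "\<And>i. i < m \<Longrightarrow> triple (I i) c t (I (Suc i))"
    and guard: "\<And>i s. I i s \<Longrightarrow> i \<le> m \<Longrightarrow> bval b (vars s) \<longleftrightarrow> i < m"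
  shows "triple (I 0) (While b c) (bcost b + m * (bcost b + t)) (I m)"
proof -
  have "\<exists>t' s'. exec (While b c) s t' s' \<and> t' \<le> bcost b + (m - i) * (bcost b + t) \<and> I m s'"
    if "I i s" "i \<le> m" for i s
    using that
  proof (induction "m - i" arbitrary: i s)
    case 0
    then have "i = m" by simp
    then show ?case using exec.WhileFalse[of b s c] guard[OF 0(2,3)] 0 by auto
  next
    case (Suc j)
    then have i: "i < m" by simp
    then have b: "bval b (vars s)" using guard Suc.prems by blast
    obtain t1 s1 where 1: "exec c s t1 s1" "t1 \<le> t" "I (Suc i) s1"
      using body[OF i] Suc.prems unfolding triple_def by blast
    have ji: "j = m - Suc i" using Suc.hyps by simp
    obtain t2 s2 where 2: "exec (While b c) s1 t2 s2"
        "t2 \<le> bcost b + (m - Suc i) * (bcost b + t)" "I m s2"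
      using Suc.hyps(1)[OF ji 1(3)] i by auto
    have "exec (While b c) s (bcost b + t1 + t2) s2" by (rule exec.WhileTrue[OF b 1(1) 2(1)])
    moreover have "bcost b + t1 + t2 \<le> bcost b + (m - i) * (bcost b + t)"
    proof -
      have "m - i = Suc (m - Suc i)" using i by simp
      then show ?thesis using 1(2) 2(2) by simp
    qed
    ultimately show ?case using 2(3) by blast
  qed
  from this[of 0] show ?thesis unfolding triple_def by simp
qed

section \<open>The program\<close>

text \<open>
  The program fills a table \<open>T\<close> with \<open>T[l,k,s] = |ranked_box k l s|\<close>, in the order of \<open>l\<close>, \<open>k\<close>, \<open>s\<close>.
  Hook removal increases \<open>s\<close> by at most \<open>n\<close> while \<open>l\<close> decreases by one. Hence the values for
  \<open>s \<le> (n - l) n\<close> need only values in the same range, and \<open>m\<close> holds this bound, which is lowered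
  by \<open>n\<close> after each \<open>l\<close>. The variable \<open>p\<close> is the boundary value, 1 for even and 0 for odd \<open>s\<close>.
\<close>

definition cell_prog :: com where
  "cell_prog =
    Cond (Eq (Var ''k'') (Const 0)) (Store ''T'' [Var ''l'', Var ''k'', Var ''s''] (Var ''p''))
   (Cond (Eq (Var ''l'') (Const 0)) (Store ''T'' [Var ''l'', Var ''k'', Var ''s''] (Var ''p''))
   (Seq (Load ''x'' ''T'' [Minus (Var ''l'') (Const 1), Var ''k'', Var ''s''])
   (Seq (Load ''y'' ''T'' [Var ''l'', Minus (Var ''k'') (Const 1), Var ''s''])
   (Seq (Load ''z'' ''T'' [Minus (Var ''l'') (Const 1), Minus (Var ''k'') (Const 1), Var ''s''])
   (Seq (Assign ''u'' (Minus (Minus (Plus (Var ''s'') (Var ''l'')) (Var ''k'')) (Const 1)))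
   (Seq (Cond (Less (Var ''u'') (Const 0)) (Assign ''w'' (Const 0))
          (Load ''w'' ''T'' [Minus (Var ''l'') (Const 1), Minus (Var ''k'') (Const 1), Var ''u'']))
   (Store ''T'' [Var ''l'', Var ''k'', Var ''s'']
     (Plus (Minus (Plus (Var ''x'') (Var ''y'')) (Var ''z'')) (Var ''w'')))))))))"

definition s_body :: com where
  "s_body = Seq cell_prog
     (Seq (Assign ''p'' (Minus (Const 1) (Var ''p''))) (Assign ''s'' (Plus (Var ''s'') (Const 1))))"

definition k_body :: com where
  "k_body = Seq (Assign ''s'' (Const 0)) (Seq (Assign ''p'' (Const 1))
     (Seq (While (Less (Var ''s'') (Plus (Var ''m'') (Const 1))) s_body)
     (Assign ''k'' (Plus (Var ''k'') (Const 1)))))"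

definition l_body :: com where
  "l_body = Seq (Assign ''k'' (Const 0))
     (Seq (While (Less (Var ''k'') (Plus (Var ''n'') (Const 1))) k_body)
     (Seq (Assign ''m'' (Minus (Var ''m'') (Var ''n'')))
     (Assign ''l'' (Plus (Var ''l'') (Const 1)))))"

text \<open>
  There is no multiplication, so \<open>m = n * n\<close> is computed by repeated addition. The variables \<open>i\<close>,
  \<open>m\<close> and \<open>l\<close> start at 0, the default value of a variable.
\<close>

definition square_body :: com where
  "square_body = Seq (Assign ''m'' (Plus (Var ''m'') (Var ''n''))) (Assign ''i'' (Plus (Var ''i'') (Const 1)))"

definition count_prog :: com where
  "count_prog =
     Seq (While (Less (Var ''i'') (Var ''n'')) square_body)
    (Seq (New ''T'' [Plus (Var ''n'') (Const 1), Plus (Var ''n'') (Const 1), Plus (Var ''m'') (Const 1)])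
    (Seq (While (Less (Var ''l'') (Plus (Var ''n'') (Const 1))) l_body)
    (Seq (Load ''x'' ''T'' [Var ''n'', Var ''n'', Const 0])
    (Seq (Load ''y'' ''T'' [Minus (Var ''n'') (Const 1), Minus (Var ''n'') (Const 1), Const 0])
    (Assign ''output'' (Minus (Var ''x'') (Var ''y'')))))))"

definition box_count :: "nat \<Rightarrow> nat \<Rightarrow> int \<Rightarrow> int" where
  "box_count k l s = int (card (ranked_box k l s))"

lemma box_count_base: "k = 0 \<or> l = 0 \<Longrightarrow> 0 \<le> s \<Longrightarrow> box_count k l s = (if even s then 1 else 0)"
  by (simp add: box_count_def ranked_box_base)

lemma box_count_rec: "0 \<le> s \<Longrightarrow> box_count (Suc k) (Suc l) s = box_count (Suc k) l s + box_count k (Suc l) s - box_count k l s + box_count k l (s + int l - int k - 1)"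
  unfolding box_count_def by (rule ranked_box_rec)

lemma box_count_neg: "s < 0 \<Longrightarrow> box_count k l s = 0"
  by (simp add: box_count_def ranked_box_def)

text \<open>
  All entries with \<open>done\<close> are correct, as far as they lie in the range \<open>s \<le> (n - l) n\<close>; the state of
  the loops is expressed by \<open>done\<close>, in the lexicographic order of \<open>l\<close>, \<open>k\<close>, \<open>s\<close>.
\<close>

definition filled :: "nat \<Rightarrow> (nat \<Rightarrow> nat \<Rightarrow> nat \<Rightarrow> bool) \<Rightarrow> state \<Rightarrow> bool" where
  "filled n done st \<longleftrightarrow> vars st ''n'' = int n
     \<and> dom (arrs st) = {''input'', ''T''} \<and> fst (the (arrs st ''input'')) = [n]
     \<and> (\<exists>f. arrs st ''T'' = Some ([n + 1, n + 1, n * n + 1], f)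
       \<and> (\<forall>l k s. done l k s \<longrightarrow> l \<le> n \<longrightarrow> k \<le> n \<longrightarrow> s \<le> (n - l) * n \<longrightarrow>
            f [int l, int k, int s] = box_count k l (int s)))"

definition l_inv :: "nat \<Rightarrow> nat \<Rightarrow> state \<Rightarrow> bool" where
  "l_inv n l st \<longleftrightarrow> filled n (\<lambda>l' k' s'. l' < l) st
     \<and> vars st ''l'' = int l \<and> vars st ''m'' = (int n - int l) * int n"

definition k_inv :: "nat \<Rightarrow> nat \<Rightarrow> nat \<Rightarrow> state \<Rightarrow> bool" where
  "k_inv n l k st \<longleftrightarrow> filled n (\<lambda>l' k' s'. l' < l \<or> l' = l \<and> k' < k) st
     \<and> vars st ''l'' = int l \<and> vars st ''m'' = (int n - int l) * int n \<and> vars st ''k'' = int k"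

definition s_inv :: "nat \<Rightarrow> nat \<Rightarrow> nat \<Rightarrow> nat \<Rightarrow> state \<Rightarrow> bool" where
  "s_inv n l k s st \<longleftrightarrow> filled n (\<lambda>l' k' s'. l' < l \<or> l' = l \<and> (k' < k \<or> k' = k \<and> s' < s)) st
     \<and> vars st ''l'' = int l \<and> vars st ''m'' = (int n - int l) * int n \<and> vars st ''k'' = int k
     \<and> vars st ''s'' = int s \<and> vars st ''p'' = (if even s then 1 else 0)"

definition s_post :: "nat \<Rightarrow> nat \<Rightarrow> nat \<Rightarrow> nat \<Rightarrow> state \<Rightarrow> bool" where
  "s_post n l k s st \<longleftrightarrow> filled n (\<lambda>l' k' s'. l' < l \<or> l' = l \<and> (k' < k \<or> k' = k \<and> s' \<le> s)) st
     \<and> vars st ''l'' = int l \<and> vars st ''m'' = (int n - int l) * int n \<and> vars st ''k'' = int k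
     \<and> vars st ''s'' = int s \<and> vars st ''p'' = (if even s then 1 else 0)"

lemma in_bounds_3:
  "in_bounds [a, b, c] [d, e, f] \<longleftrightarrow> 0 \<le> a \<and> a < int d \<and> 0 \<le> b \<and> b < int e \<and> 0 \<le> c \<and> c < int f"
  by (auto simp: in_bounds_def)


lemma filled_update:
  assumes "filled n done st" and "arrs st ''T'' = Some (ds, f)"
    and "arrs st' = (arrs st)(''T'' \<mapsto> (ds, f([int l, int k, int s] := box_count k l (int s))))"
    and "vars st' ''n'' = vars st ''n''"
    and "\<And>l' k' s'. done' l' k' s' \<Longrightarrow> done l' k' s' \<or> l' = l \<and> k' = k \<and> s' = s"
  shows "filled n done' st'"
proof -
  obtain f0 where f0: "arrs st ''T'' = Some ([n + 1, n + 1, n * n + 1], f0)"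
    and F: "\<And>l k s. done l k s \<Longrightarrow> l \<le> n \<Longrightarrow> k \<le> n \<Longrightarrow> s \<le> (n - l) * n \<Longrightarrow>
        f0 [int l, int k, int s] = box_count k l (int s)"
    using assms(1) unfolding filled_def by blast
  have eq: "ds = [n + 1, n + 1, n * n + 1]" "f0 = f" using f0 assms(2) by simp_all
  let ?f = "f([int l, int k, int s] := box_count k l (int s))"
  have "?f [int l', int k', int s'] = box_count k' l' (int s')"
    if "done' l' k' s'" "l' \<le> n" "k' \<le> n" "s' \<le> (n - l') * n" for l' k' s'
  proof (cases "l' = l \<and> k' = k \<and> s' = s")
    case False
    then have "done l' k' s'" using assms(5) that(1) by blast
    then show ?thesis using F[of l' k' s'] that False eq by auto
  qed simp
  moreover have "dom (arrs st') = {''input'', ''T''}" "fst (the (arrs st' ''input'')) = [n]"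
    "vars st' ''n'' = int n"
    using assms(1,3,4) unfolding filled_def by auto
  ultimately show ?thesis unfolding filled_def using assms(3) eq by simp
qed

text \<open>
  The four entries read lie in row \<open>l - 1\<close> or in column \<open>k - 1\<close> of row \<open>l\<close>, so they are filled, and
  the shifted index \<open>u = s + l - k - 1\<close> is at most \<open>s + n\<close>, hence within the range for \<open>l - 1\<close>.
\<close>

lemma cell_correct:
  assumes l: "l \<le> n" and k: "k \<le> n" and s: "s \<le> (n - l) * n"
  shows "triple (s_inv n l k s) cell_prog 40 (s_post n l k s)"
proof -
  have sn: "s \<le> n * n" using s by (rule le_trans) simp
  show ?thesis
    apply (rule triple_conseq)
      apply (unfold cell_prog_def)
       apply (rule triple_Cond triple_Seq triple_Load triple_Store triple_Assign)+
    subgoal for st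
    proof -
      assume inv: "s_inv n l k s st"
      let ?done = "\<lambda>l' k' s'. l' < l \<or> l' = l \<and> (k' < k \<or> k' = k \<and> s' < s)"
      have F: "filled n ?done st"
        and v: "vars st ''l'' = int l" "vars st ''m'' = (int n - int l) * int n" "vars st ''k'' = int k"
          "vars st ''s'' = int s" "vars st ''p'' = (if even s then 1 else 0)"
        using inv unfolding s_inv_def by blast+
      obtain f where f: "arrs st ''T'' = Some ([n + 1, n + 1, n * n + 1], f)"
        and fG: "\<And>l k s. ?done l k s \<Longrightarrow> l \<le> n \<Longrightarrow> k \<le> n \<Longrightarrow> s \<le> (n - l) * n \<Longrightarrow>
            f [int l, int k, int s] = box_count k l (int s)"
        using F unfolding filled_def by blast
      \<comment> \<open>Opaque names for the dimensions, the indices and the new value keep the simplifier from rewriting indices inside the array update.\<close>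
      define ds where "ds = [n + 1, n + 1, n * n + 1]"
      define g where "g = box_count k l (int s)"
      define L K S where "L = int l" and "K = int k" and "S = int s"
      have vL: "vars st ''l'' = L" and vK: "vars st ''k'' = K" and vS: "vars st ''s'' = S"
        and fds: "arrs st ''T'' = Some (ds, f)"
        using v f by (simp_all add: L_def K_def S_def ds_def)
      have post: "s_post n l k s st'"
        if "arrs st' = (arrs st)(''T'' \<mapsto> (ds, f([L, K, S] := g)))"
          "vars st' ''n'' = vars st ''n''" "vars st' ''l'' = vars st ''l''" "vars st' ''m'' = vars st ''m''"
          "vars st' ''k'' = vars st ''k''" "vars st' ''s'' = vars st ''s''" "vars st' ''p'' = vars st ''p''" for st'
      proof -
        have "filled n (\<lambda>l' k' s'. l' < l \<or> l' = l \<and> (k' < k \<or> k' = k \<and> s' \<le> s)) st'"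
          by (rule filled_update[OF F fds that(1,2)[unfolded L_def K_def S_def g_def]]) auto
        then show ?thesis using that v unfolding s_post_def by simp
      qed
      have inb: "in_bounds [L, K, S] ds"
        using l k sn by (simp add: in_bounds_3 ds_def L_def K_def S_def del: of_nat_mult of_nat_add of_nat_Suc)
      have b1: "bval (Eq (Var ''k'') (Const 0)) (vars st) \<longleftrightarrow> k = 0"
        and b2: "bval (Eq (Var ''l'') (Const 0)) (vars st) \<longleftrightarrow> l = 0"
        using v by simp_all
      show ?thesis
      proof (cases "k = 0 \<or> l = 0")
        case True
        then have "vars st ''p'' = g" using box_count_base v by (simp add: g_def)
        then have "\<exists>ds f. arrs st ''T'' = Some (ds, f)
            \<and> in_bounds (avals [Var ''l'', Var ''k'', Var ''s''] (vars st)) ds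
            \<and> s_post n l k s (st\<lparr>arrs := (arrs st)(''T'' \<mapsto>
                (ds, f(avals [Var ''l'', Var ''k'', Var ''s''] (vars st) := aval (Var ''p'') (vars st))))\<rparr>)"
          by (simp add: fds avals_def vL vK vS inb post)
        then show ?thesis unfolding b1 b2 using True
          by (cases "k = 0") (simp_all only: if_True if_False simp_thms)
      next
        case False
        then obtain l1 k1 where lk: "l = Suc l1" "k = Suc k1" by (meson not0_implies_Suc)
        define L1 K1 U where "L1 = int l1" and "K1 = int k1" and "U = S + L - K - 1"
        have "(n - l) * n \<le> (n - l1) * n" using lk by (intro mult_le_mono1) simp
        then have s1: "s \<le> (n - l1) * n" using s by linarith
        have U: "\<exists>u. U = int u \<and> u \<le> (n - l1) * n" if U0: "0 \<le> U"
        proof -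
          obtain u where u: "U = int u" using U0 zero_le_imp_eq_int by blast
          have "n - l1 = Suc (n - l)" using lk l by simp
          then have "s + n \<le> (n - l1) * n" using s by simp
          moreover have "u \<le> s + n" using u U_def l unfolding L_def K_def S_def by linarith
          ultimately show ?thesis using u by (intro exI[of _ u]) simp
        qed
        have f1: "f [L1, K, S] = box_count k l1 (int s)"
          unfolding L1_def K_def S_def by (rule fG) (use lk l k s1 in simp_all)
        have f2: "f [L, K1, S] = box_count k1 l (int s)"
          unfolding L_def K1_def S_def by (rule fG) (use lk l k s in simp_all)
        have f3: "f [L1, K1, S] = box_count k1 l1 (int s)"
          unfolding L1_def K1_def S_def by (rule fG) (use lk l k s1 in simp_all)
        have f4: "f [L1, K1, U] = box_count k1 l1 U" if U0: "0 \<le> U"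
        proof -
          obtain u where u: "U = int u" "u \<le> (n - l1) * n" using U[OF U0] by blast
          show ?thesis unfolding L1_def K1_def u(1) by (rule fG) (use lk l k u in simp_all)
        qed
        have rec: "g = box_count k l1 (int s) + box_count k1 l (int s) - box_count k1 l1 (int s) + box_count k1 l1 U"
        proof -
          have "U = int s + int l1 - int k1 - 1" by (simp add: U_def L_def K_def S_def lk)
          then show ?thesis using box_count_rec[of "int s" k1 l1] by (simp only: g_def lk)
        qed
        have d: "L - 1 = L1" "K - 1 = K1" "S + L - K - 1 = U"
          using lk by (simp_all add: L_def K_def L1_def K1_def U_def)
        have inb': "in_bounds [L1, K, S] ds" "in_bounds [L, K1, S] ds" "in_bounds [L1, K1, S] ds"
          using l k sn lk by (simp_all add: in_bounds_3 ds_def L_def K_def S_def L1_def K1_def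
              del: of_nat_mult of_nat_add of_nat_Suc)
        have inbU: "in_bounds [L1, K1, U] ds" if U0: "0 \<le> U"
        proof -
          obtain u where u: "U = int u" "u \<le> (n - l1) * n" using U[OF U0] by blast
          moreover have "(n - l1) * n \<le> n * n" by simp
          ultimately have "u \<le> n * n" by linarith
          then show ?thesis using l k lk
            by (simp add: in_bounds_3 ds_def L1_def K1_def u(1) del: of_nat_mult of_nat_add of_nat_Suc)
        qed
        show ?thesis
        proof (cases "U < 0")
          case True
          then have g: "f [L1, K, S] + f [L, K1, S] - f [L1, K1, S] = g"
            using rec box_count_neg[of U k1 l1] f1 f2 f3 by simp
          show ?thesis unfolding b1 b2 using False True
            by (simp add: fds avals_def vL vK vS inb inb' post d g)
        next
          case False
          then have g: "f [L1, K, S] + f [L, K1, S] - f [L1, K1, S] + f [L1, K1, U] = g"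
            using rec f1 f2 f3 f4 by simp
          show ?thesis unfolding b1 b2 using False \<open>\<not> (k = 0 \<or> l = 0)\<close>
            by (simp add: fds avals_def vL vK vS inb inb' inbU post d g)
        qed
      qed
    qed
    by (simp_all add: acosts_def)
qed


text \<open>
  An inner loop ends when \<open>s\<close> or \<open>k\<close> has left its range, so weakening may use that the index is in
  range: the condition of the next outer loop then follows.
\<close>

lemma filled_weaken:
  assumes "filled n done st" and "arrs st' = arrs st" and "vars st' ''n'' = vars st ''n''"
    and "\<And>l k s. done' l k s \<Longrightarrow> l \<le> n \<Longrightarrow> k \<le> n \<Longrightarrow> s \<le> (n - l) * n \<Longrightarrow> done l k s"
  shows "filled n done' st'"
proof -
  obtain f where f: "arrs st ''T'' = Some ([n + 1, n + 1, n * n + 1], f)"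
    and F: "\<And>l k s. done l k s \<Longrightarrow> l \<le> n \<Longrightarrow> k \<le> n \<Longrightarrow> s \<le> (n - l) * n \<Longrightarrow>
        f [int l, int k, int s] = box_count k l (int s)"
    using assms(1) unfolding filled_def by blast
  then have "\<exists>f. arrs st' ''T'' = Some ([n + 1, n + 1, n * n + 1], f)
       \<and> (\<forall>l k s. done' l k s \<longrightarrow> l \<le> n \<longrightarrow> k \<le> n \<longrightarrow> s \<le> (n - l) * n \<longrightarrow>
            f [int l, int k, int s] = box_count k l (int s))"
    using assms(2,4) by (intro exI[of _ f]) auto
  then show ?thesis using assms(1-3) unfolding filled_def by simp
qed

lemma s_body_correct:
  assumes "l \<le> n" "k \<le> n" "s \<le> (n - l) * n"
  shows "triple (s_inv n l k s) s_body 44 (s_inv n l k (Suc s))"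
proof -
  have step: "s_inv n l k (Suc s) (st\<lparr>vars := (vars st)(''p'' := 1 - vars st ''p'', ''s'' := vars st ''s'' + 1)\<rparr>)"
    (is "s_inv n l k (Suc s) ?st") if st: "s_post n l k s st" for st
  proof -
    have "filled n (\<lambda>l' k' s'. l' < l \<or> l' = l \<and> (k' < k \<or> k' = k \<and> s' < Suc s)) ?st"
      by (rule filled_weaken[OF conjunct1[OF st[unfolded s_post_def]]]) auto
    then show ?thesis using st by (simp add: s_inv_def s_post_def)
  qed
  show ?thesis unfolding s_body_def
    by (rule triple_then[OF cell_correct[OF assms] triple_Seq[OF triple_Assign triple_Assign]])
      (use step in simp_all)
qed

lemma k_body_correct:
  assumes l: "l \<le> n" and k: "k \<le> n"
  shows "triple (k_inv n l k) k_body (52 + n * n * 46) (k_inv n l (Suc k))"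
proof -
  let ?b = "Less (Var ''s'') (Plus (Var ''m'') (Const 1))"
  have loop: "triple (s_inv n l k 0) (While ?b s_body)
      (bcost ?b + Suc ((n - l) * n) * (bcost ?b + 44)) (s_inv n l k (Suc ((n - l) * n)))"
  proof (rule triple_For)
    show "triple (s_inv n l k i) s_body 44 (s_inv n l k (Suc i))" if "i < Suc ((n - l) * n)" for i
      by (rule s_body_correct[OF l k]) (use that in simp)
    fix i st assume "s_inv n l k i st"
    moreover have "(int n - int l) * int n = int ((n - l) * n)" using l by (simp add: of_nat_diff)
    ultimately have "vars st ''s'' = int i" "vars st ''m'' = int ((n - l) * n)" by (simp_all add: s_inv_def)
    then show "bval ?b (vars st) \<longleftrightarrow> i < Suc ((n - l) * n)"
      by (simp del: of_nat_mult) linarith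
  qed
  have exit: "k_inv n l (Suc k) (st\<lparr>vars := (vars st)(''k'' := vars st ''k'' + 1)\<rparr>)" (is "k_inv n l (Suc k) ?st")
    if st: "s_inv n l k (Suc ((n - l) * n)) st" for st
  proof -
    have "filled n (\<lambda>l' k' s'. l' < l \<or> l' = l \<and> k' < Suc k) ?st"
      by (rule filled_weaken[OF conjunct1[OF st[unfolded s_inv_def]]]) auto
    then show ?thesis using st by (simp add: s_inv_def k_inv_def)
  qed
  have entry: "s_inv n l k 0 (st\<lparr>vars := (vars st)(''s'' := 0, ''p'' := 1)\<rparr>)" (is "s_inv n l k 0 ?st")
    if st: "k_inv n l k st" for st
  proof -
    have "filled n (\<lambda>l' k' s'. l' < l \<or> l' = l \<and> (k' < k \<or> k' = k \<and> s' < 0)) ?st"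
      by (rule filled_weaken[OF conjunct1[OF st[unfolded k_inv_def]]]) auto
    then show ?thesis using st by (simp add: s_inv_def k_inv_def)
  qed
  have le: "(n - l) * n \<le> n * n" by simp
  have last: "triple (s_inv n l k 0) (Seq (While ?b s_body) (Assign ''k'' (Plus (Var ''k'') (Const 1))))
      (50 + n * n * 46) (k_inv n l (Suc k))"
    by (rule triple_then[OF loop triple_Assign]) (use exit le in simp_all)
  show ?thesis unfolding k_body_def
    by (rule triple_conseq[OF triple_Seq[OF triple_Seq[OF last triple_Assign] triple_Assign]])
      (use entry in simp_all)
qed

lemma l_body_correct:
  assumes l: "l \<le> n"
  shows "triple (l_inv n l) l_body (7 + Suc n * (54 + n * n * 46)) (l_inv n (Suc l))"
proof -
  let ?b = "Less (Var ''k'') (Plus (Var ''n'') (Const 1))"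
  have loop: "triple (k_inv n l 0) (While ?b k_body)
      (bcost ?b + Suc n * (bcost ?b + (52 + n * n * 46))) (k_inv n l (Suc n))"
  proof (rule triple_For)
    show "triple (k_inv n l i) k_body (52 + n * n * 46) (k_inv n l (Suc i))" if "i < Suc n" for i
      by (rule k_body_correct[OF l]) (use that in simp)
    fix i st assume "k_inv n l i st"
    then have "vars st ''k'' = int i" "vars st ''n'' = int n" by (simp_all add: k_inv_def filled_def)
    then show "bval ?b (vars st) \<longleftrightarrow> i < Suc n" by simp linarith
  qed
  have exit: "l_inv n (Suc l)
      (st\<lparr>vars := (vars st)(''m'' := vars st ''m'' - vars st ''n'', ''l'' := vars st ''l'' + 1)\<rparr>)"
    (is "l_inv n (Suc l) ?st") if st: "k_inv n l (Suc n) st" for st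
  proof -
    have "filled n (\<lambda>l' k' s'. l' < Suc l) ?st"
      by (rule filled_weaken[OF conjunct1[OF st[unfolded k_inv_def]]]) auto
    moreover have "vars st ''n'' = int n" using st by (simp add: k_inv_def filled_def)
    ultimately show ?thesis using st by (simp add: k_inv_def l_inv_def algebra_simps)
  qed
  have entry: "k_inv n l 0 (st\<lparr>vars := (vars st)(''k'' := 0)\<rparr>)" (is "k_inv n l 0 ?st")
    if st: "l_inv n l st" for st
  proof -
    have "filled n (\<lambda>l' k' s'. l' < l \<or> l' = l \<and> k' < 0) ?st"
      by (rule filled_weaken[OF conjunct1[OF st[unfolded l_inv_def]]]) auto
    then show ?thesis using st by (simp add: l_inv_def k_inv_def)
  qed
  have last: "triple (k_inv n l 0)
      (Seq (While ?b k_body) (Seq (Assign ''m'' (Minus (Var ''m'') (Var ''n''))) (Assign ''l'' (Plus (Var ''l'') (Const 1)))))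
      (6 + Suc n * (54 + n * n * 46)) (l_inv n (Suc l))"
    by (rule triple_then[OF loop triple_Seq[OF triple_Assign triple_Assign]]) (use exit in simp_all)
  show ?thesis unfolding l_body_def
    by (rule triple_conseq[OF triple_Seq[OF last triple_Assign]]) (use entry in simp_all)
qed

definition final :: "nat \<Rightarrow> state \<Rightarrow> bool" where
  "final n st \<longleftrightarrow> vars st ''output'' = int (card (D n)) \<and> dom (arrs st) = {''input'', ''T''}
     \<and> fst (the (arrs st ''input'')) = [n] \<and> fst (the (arrs st ''T'')) = [n + 1, n + 1, n * n + 1]"

text \<open>
  The last step reads off \<open>|D n|\<close> as the number of graphical partitions with at most \<open>n\<close> parts minus the
  number of those with at most \<open>n - 1\<close> parts.
\<close>

lemma count_prog_correct:
  assumes n: "1 \<le> n" and len: "length xs = n"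
  shows "triple (\<lambda>s. s = init_state n xs) count_prog
    (25 + 5 * n + (n + 1) * ((n + 1) * (n * n + 1)) + Suc n * (9 + Suc n * (54 + n * n * 46))) (final n)"
proof -
  let ?dims = "[n + 1, n + 1, n * n + 1]"
  define sq :: "nat \<Rightarrow> state \<Rightarrow> bool" where "sq = (\<lambda>i st. vars st ''n'' = int n \<and> vars st ''i'' = int i \<and> vars st ''m'' = int (i * n)
      \<and> vars st ''l'' = 0 \<and> arrs st = arrs (init_state n xs))"
  let ?bi = "Less (Var ''i'') (Var ''n'')"
  have square: "triple (sq 0) (While ?bi square_body) (bcost ?bi + n * (bcost ?bi + 4)) (sq n)"
  proof (rule triple_For)
    show "triple (sq i) square_body 4 (sq (Suc i))" for i
      unfolding square_body_def
      by (rule triple_conseq[OF triple_Seq[OF triple_Assign triple_Assign]]) (auto simp: sq_def algebra_simps)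
  qed (auto simp: sq_def)
  let ?bl = "Less (Var ''l'') (Plus (Var ''n'') (Const 1))"
  let ?tl = "7 + Suc n * (54 + n * n * 46)"
  have loop: "triple (l_inv n 0) (While ?bl l_body) (bcost ?bl + Suc n * (bcost ?bl + ?tl)) (l_inv n (Suc n))"
  proof (rule triple_For)
    show "triple (l_inv n i) l_body ?tl (l_inv n (Suc i))" if "i < Suc n" for i
      by (rule l_body_correct) (use that in simp)
    fix i st assume "l_inv n i st"
    then have "vars st ''l'' = int i" "vars st ''n'' = int n" by (simp_all add: l_inv_def filled_def)
    then show "bval ?bl (vars st) \<longleftrightarrow> i < Suc n" by simp linarith
  qed
  let ?read = "Seq (Load ''x'' ''T'' [Var ''n'', Var ''n'', Const 0])
    (Seq (Load ''y'' ''T'' [Minus (Var ''n'') (Const 1), Minus (Var ''n'') (Const 1), Const 0])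
    (Assign ''output'' (Minus (Var ''x'') (Var ''y''))))"
  have read: "triple (l_inv n (Suc n)) ?read 8 (final n)"
    apply (rule triple_conseq[OF triple_Seq[OF triple_Seq[OF triple_Assign triple_Load] triple_Load]])
    subgoal for st
    proof -
      assume st: "l_inv n (Suc n) st"
      then have vn: "vars st ''n'' = int n"
        and doms: "dom (arrs st) = {''input'', ''T''}" "fst (the (arrs st ''input'')) = [n]"
        unfolding l_inv_def filled_def by blast+
      obtain f where arr: "arrs st ''T'' = Some (?dims, f)"
        and F: "\<And>l k s. l < Suc n \<Longrightarrow> l \<le> n \<Longrightarrow> k \<le> n \<Longrightarrow> s \<le> (n - l) * n \<Longrightarrow>
            f [int l, int k, int s] = box_count k l (int s)"
        using st unfolding l_inv_def filled_def by blast
      have 1: "f [int n, int n, 0] = box_count n n 0" using F[of n n 0] by simp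
      have 2: "f [int n - 1, int n - 1, 0] = box_count (n - 1) (n - 1) 0"
        using F[of "n - 1" "n - 1" 0] n by (simp add: of_nat_diff)
      have 3: "box_count n n 0 - box_count (n - 1) (n - 1) 0 = int (card (D n))"
        using card_D_ranked_box[OF n] by (simp add: box_count_def)
      show ?thesis using n vn arr doms 1 2 3
        by (simp add: avals_def in_bounds_3 final_def del: One_nat_def)
    qed
    by (simp add: acosts_def)
  have run: "triple (sq n) (Seq (New ''T'' [Plus (Var ''n'') (Const 1), Plus (Var ''n'') (Const 1), Plus (Var ''m'') (Const 1)])
      (Seq (While ?bl l_body) ?read)) (4 + (n + 1) * ((n + 1) * (n * n + 1)) + (10 + Suc n * (9 + Suc n * (54 + n * n * 46)))) (final n)"
  proof (rule triple_conseq[OF triple_Seq[OF triple_then[OF loop read _ le_refl] triple_New[where ds = ?dims]]])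
    fix st assume st: "sq n st"
    let ?st = "st\<lparr>arrs := (arrs st)(''T'' \<mapsto> (?dims, \<lambda>_. 0))\<rparr>"
    have "dom (arrs ?st) = {''input'', ''T''}" using st by (auto simp: sq_def init_state_def)
    then have "filled n (\<lambda>l' k' s'. l' < 0) ?st"
      using st len by (simp add: filled_def sq_def init_state_def)
    then have "l_inv n 0 ?st" using st by (simp add: l_inv_def sq_def)
    then show "arrs st ''T'' = None \<and>
        avals [Plus (Var ''n'') (Const 1), Plus (Var ''n'') (Const 1), Plus (Var ''m'') (Const 1)] (vars st) = map int ?dims \<and>
        l_inv n 0 ?st"
      using st by (simp add: sq_def avals_def init_state_def)
  qed (simp_all add: acosts_def)
  show ?thesis unfolding count_prog_def
  proof (rule triple_conseq[OF triple_then[OF square run _ le_refl]])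
    show "sq 0 s" if "s = init_state n xs" for s
      using that by (simp add: sq_def init_state_def)
  qed simp_all
qed

lemma polynomial_bounds:
  fixes n :: nat
  assumes "1 \<le> n"
  shows "25 + 5 * n + (n + 1) * ((n + 1) * (n * n + 1)) + Suc n * (9 + Suc n * (54 + n * n * 46)) \<le> 456 * n ^ 5"
    and "b + (n + (n + 1) * ((n + 1) * (n * n + 1))) \<le> (b + 9) * n ^ 5"
proof -
  have p: "n ^ i \<le> n ^ 5" if "i \<le> 5" for i using assms that by (rule power_increasing[rotated])
  have p0: "1 \<le> n ^ 5" and p1: "n \<le> n ^ 5" and p2: "n ^ 2 \<le> n ^ 5" and p3: "n ^ 3 \<le> n ^ 5" and p4: "n ^ 4 \<le> n ^ 5"
    using p[of 0] p[of 1] p[of 2] p[of 3] p[of 4] by simp_all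
  have "25 + 5 * n + (n + 1) * ((n + 1) * (n * n + 1)) + Suc n * (9 + Suc n * (54 + n * n * 46))
      = 47 * n ^ 4 + 94 * n ^ 3 + 102 * n ^ 2 + 124 * n + 89"
    by (simp add: algebra_simps power2_eq_square power3_eq_cube power4_eq_xxxx)
  then show "25 + 5 * n + (n + 1) * ((n + 1) * (n * n + 1)) + Suc n * (9 + Suc n * (54 + n * n * 46)) \<le> 456 * n ^ 5"
    using p0 p1 p2 p3 p4 by linarith
  have "n + (n + 1) * ((n + 1) * (n * n + 1)) = n ^ 4 + 2 * n ^ 3 + 2 * n ^ 2 + 3 * n + 1"
    by (simp add: algebra_simps power2_eq_square power3_eq_cube power4_eq_xxxx)
  then have "n + (n + 1) * ((n + 1) * (n * n + 1)) \<le> 9 * n ^ 5"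
    using p0 p1 p2 p3 p4 by linarith
  moreover have "b * 1 \<le> b * n ^ 5" using p0 by (rule mult_le_mono2)
  ultimately show "b + (n + (n + 1) * ((n + 1) * (n * n + 1))) \<le> (b + 9) * n ^ 5"
    by (simp only: add_mult_distrib mult_1_right)
qed

lemma bigo_of_le:
  assumes "\<And>n. 2 \<le> n \<Longrightarrow> f n \<le> c * n ^ 5"
  shows "(\<lambda>n. real (f n)) \<in> O(\<lambda>n. real n ^ 5)"
proof (rule bigoI[of _ "real c"])
  show "\<forall>\<^sub>F n in at_top. norm (real (f n)) \<le> real c * norm (real n ^ 5)"
    using eventually_ge_at_top[of 2]
  proof eventually_elim
    case (elim n)
    then have "real (f n) \<le> real (c * n ^ 5)" using assms by (intro of_nat_mono) auto
    then show ?case by simp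
  qed
qed

lemma count_prog_bounds:
  "\<exists>(c :: com) (T :: nat \<Rightarrow> nat) (S :: nat \<Rightarrow> nat).
        (\<forall>n\<ge>2. \<exists>s. exec c (init_state n (map (\<lambda>i. card (D i)) [0..<n])) (T n) s
           \<and> vars s ''output'' = int (card (D n)) \<and> space c s = S n)
      \<and> (\<lambda>n. real (T n)) \<in> O(\<lambda>n. real n ^ 5)
      \<and> (\<lambda>n. real (S n)) \<in> O(\<lambda>n. real n ^ 5)"
proof -
  define b where "b = card (insert ''n'' (cvars count_prog))"
  define S where "S n = b + (n + (n + 1) * ((n + 1) * (n * n + 1)))" for n
  have "\<exists>t s. exec count_prog (init_state n (map (\<lambda>i. card (D i)) [0..<n])) t s \<and> final n s
      \<and> t \<le> 25 + 5 * n + (n + 1) * ((n + 1) * (n * n + 1)) + Suc n * (9 + Suc n * (54 + n * n * 46))"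
    if "2 \<le> n" for n
  proof -
    have "1 \<le> n" "length (map (\<lambda>i. card (D i)) [0..<n]) = n" using that by simp_all
    from count_prog_correct[OF this] show ?thesis unfolding triple_def by blast
  qed
  then obtain T where T: "\<And>n. 2 \<le> n \<Longrightarrow> \<exists>s. exec count_prog (init_state n (map (\<lambda>i. card (D i)) [0..<n])) (T n) s \<and> final n s
      \<and> T n \<le> 25 + 5 * n + (n + 1) * ((n + 1) * (n * n + 1)) + Suc n * (9 + Suc n * (54 + n * n * 46))"
    by metis
  have space: "space count_prog s = S n" if "final n s" for n s
  proof -
    have "dom (arrs s) = {''input'', ''T''}" using that by (simp add: final_def)
    then have "space count_prog s = b + (\<Sum>A\<in>{''input'', ''T''}. prod_list (fst (the (arrs s A))))"
      by (simp only: space_def b_def)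
    then show ?thesis using that by (simp add: final_def S_def)
  qed
  show ?thesis
  proof (rule exI[of _ count_prog], rule exI[of _ T], rule exI[of _ S], intro conjI allI impI)
    show "\<exists>s. exec count_prog (init_state n (map (\<lambda>i. card (D i)) [0..<n])) (T n) s
           \<and> vars s ''output'' = int (card (D n)) \<and> space count_prog s = S n" if "2 \<le> n" for n
      using T[OF that] space[of n] unfolding final_def by metis
    show "(\<lambda>n. real (T n)) \<in> O(\<lambda>n. real n ^ 5)"
    proof (rule bigo_of_le)
      show "T n \<le> 456 * n ^ 5" if "2 \<le> n" for n
      proof -
        have "1 \<le> n" using that by simp
        from polynomial_bounds(1)[OF this] show ?thesis using T[OF that] by (meson le_trans)
      qed
    qed
    show "(\<lambda>n. real (S n)) \<in> O(\<lambda>n. real n ^ 5)"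
      by (rule bigo_of_le[of _ "b + 9"]) (use polynomial_bounds(2) in \<open>simp add: S_def\<close>)
  qed
qed

section \<open>The formula and the algorithm\<close>

theorem mainTheorem2:
  "(\<forall>n\<ge>2. card (D n) =
      card (D0 (n - 1)) + 2 * (\<Sum>N\<in>J'e n. Lam N n) + (if even (M_of n) then 1 else 0) * Lam (M_of n) n)
   \<and> (\<exists>(c :: com) (T :: nat \<Rightarrow> nat) (S :: nat \<Rightarrow> nat).
        (\<forall>n\<ge>2. \<exists>s. exec c (init_state n (map (\<lambda>i. card (D i)) [0..<n])) (T n) s
           \<and> vars s ''output'' = int (card (D n)) \<and> space c s = S n)
      \<and> (\<lambda>n. real (T n)) \<in> O(\<lambda>n. real n ^ 5)
      \<and> (\<lambda>n. real (S n)) \<in> O(\<lambda>n. real n ^ 5))"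
  using card_D_by_sum count_prog_bounds by blast

end
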